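(* Let $\mathbb{F}$ be a field and let $\mathcal{A}$ be a nonzero finite dimensional algebra over $\mathbb{F}$ (not assumed to have a unity). Then $\mathcal{A}$ is semiprime if and only if there exist an integer $r\ge 1$, positive integers $n_1,\ldots,n_r$ and division algebras $\mathcal{D}_1,\ldots,\mathcal{D}_r$ over $\mathbb{F}$ such that $\mathcal{A}\cong M_{n_1}(\mathcal{D}_1)\times\cdots\times M_{n_r}(\mathcal{D}_r)$.
   Context: An algebra over a field $\mathbb{F}$ is an $\mathbb{F}$-vector space with a bilinear associative multiplication; it is not required to have a unity. A unity of an algebra $\mathcal{A}$ is a nonzero element $1_{\mathcal{A}}\in\mathcal{A}$ with $1_{\mathcal{A}}a=a1_{\mathcal{A}}=a$ for all $a\in\mathcal{A}$. An algebra is nonzero if it contains a nonzero element, and finite dimensional if it is finite dimensional as an $\mathbb{F}$-vector space. A division algebra is an algebra with unity in which every nonzero element is invertible. $M_n(\mathcal{D})$ is the $\mathbb{F}$-algebra of $n\times n$ matrices with entries in $\mathcal{D}$ under the standard matrix operations. The direct product $\mathcal{A}_1\times\cdots\times\mathcal{A}_r$ of algebras is the Cartesian product with componentwise addition, scalar multiplication and multiplication. $\mathcal{A}\cong\mathcal{B}$ means that there is a bijective $\mathbb{F}$-linear map $\varphi:\mathcal{A}\to\mathcal{B}$ with $\varphi(ab)=\varphi(a)\varphi(b)$ for all $a,b\in\mathcal{A}$. An algebra $\mathcal{A}$ is semiprime if for all $a\in\mathcal{A}$, $a\mathcal{A}a=\{0\}$ implies $a=0$, where $a\mathcal{A}a=\{axa\mid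 x\in\mathcal{A}\}$. *)

theory Defs
  imports "HOL-Algebra.Algebra" "Jordan_Normal_Form.Missing_VectorSpace"
begin

text \<open>Algebras are carried by the record type of modules. They need not have a unity, so neither
  \<open>assoc_algebra\<close> nor the notions of isomorphism and semiprimeness below constrain the record
  field \<open>one\<close>; in an algebra without unity its value is meaningless.\<close>

locale assoc_algebra = V?: vectorspace F A
  for F (structure) and A (structure) +
  assumes mult_closed:
      "\<lbrakk>x \<in> carrier A; y \<in> carrier A\<rbrakk> \<Longrightarrow> x \<otimes>\<^bsub>A\<^esub> y \<in> carrier A"
    and mult_assoc:
      "\<lbrakk>x \<in> carrier A; y \<in> carrier A; z \<in> carrier A\<rbrakk> \<Longrightarrow>
        (x \<otimes>\<^bsub>A\<^esub> y) \<otimes>\<^bsub>A\<^esub> z = x \<otimes>\<^bsub>A\<^esub> (y \<otimes>\<^bsub>A\<^esub> z)"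
    and mult_add_left:
      "\<lbrakk>x \<in> carrier A; y \<in> carrier A; z \<in> carrier A\<rbrakk> \<Longrightarrow>
        (x \<oplus>\<^bsub>A\<^esub> y) \<otimes>\<^bsub>A\<^esub> z = x \<otimes>\<^bsub>A\<^esub> z \<oplus>\<^bsub>A\<^esub> y \<otimes>\<^bsub>A\<^esub> z"
    and mult_add_right:
      "\<lbrakk>x \<in> carrier A; y \<in> carrier A; z \<in> carrier A\<rbrakk> \<Longrightarrow>
        x \<otimes>\<^bsub>A\<^esub> (y \<oplus>\<^bsub>A\<^esub> z) = x \<otimes>\<^bsub>A\<^esub> y \<oplus>\<^bsub>A\<^esub> x \<otimes>\<^bsub>A\<^esub> z"
    and mult_smult_left:
      "\<lbrakk>c \<in> carrier F; x \<in> carrier A; y \<in> carrier A\<rbrakk> \<Longrightarrow>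
        (c \<odot>\<^bsub>A\<^esub> x) \<otimes>\<^bsub>A\<^esub> y = c \<odot>\<^bsub>A\<^esub> (x \<otimes>\<^bsub>A\<^esub> y)"
    and mult_smult_right:
      "\<lbrakk>c \<in> carrier F; x \<in> carrier A; y \<in> carrier A\<rbrakk> \<Longrightarrow>
        x \<otimes>\<^bsub>A\<^esub> (c \<odot>\<^bsub>A\<^esub> y) = c \<odot>\<^bsub>A\<^esub> (x \<otimes>\<^bsub>A\<^esub> y)"

text \<open>Here \<open>one\<close> is the unity: the locale \<open>monoid\<close> makes it neutral and \<open>Units\<close> refers to it.\<close>

locale division_algebra = assoc_algebra F D + D?: monoid D
  for F (structure) and D (structure) +
  assumes unity_nonzero: "\<one>\<^bsub>D\<^esub> \<noteq> \<zero>\<^bsub>D\<^esub>"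
    and nonzero_invertible: "Units D = carrier D - {\<zero>\<^bsub>D\<^esub>}"

text \<open>Matrices are extensional functions on index pairs, so that equality of functions is equality
  of matrices.\<close>

definition matrix_algebra ::
  "nat \<Rightarrow> ('f, 'd, 'm) module_scheme \<Rightarrow> ('f, nat \<times> nat \<Rightarrow> 'd) module" where
  "matrix_algebra n D =
    \<lparr>carrier = {..<n} \<times> {..<n} \<rightarrow>\<^sub>E carrier D,
     monoid.mult = (\<lambda>M N. \<lambda>(i, j)\<in>{..<n} \<times> {..<n}. \<Oplus>\<^bsub>D\<^esub>k\<in>{..<n}. M (i, k) \<otimes>\<^bsub>D\<^esub> N (k, j)),
     monoid.one = (\<lambda>(i, j)\<in>{..<n} \<times> {..<n}. if i = j then \<one>\<^bsub>D\<^esub> else \<zero>\<^bsub>D\<^esub>),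
     ring.zero = (\<lambda>(i, j)\<in>{..<n} \<times> {..<n}. \<zero>\<^bsub>D\<^esub>),
     ring.add = (\<lambda>M N. \<lambda>(i, j)\<in>{..<n} \<times> {..<n}. M (i, j) \<oplus>\<^bsub>D\<^esub> N (i, j)),
     module.smult = (\<lambda>c M. \<lambda>(i, j)\<in>{..<n} \<times> {..<n}. c \<odot>\<^bsub>D\<^esub> M (i, j))\<rparr>"

definition product_algebra ::
  "'i set \<Rightarrow> ('i \<Rightarrow> ('f, 'b, 'm) module_scheme) \<Rightarrow> ('f, 'i \<Rightarrow> 'b) module" where
  "product_algebra I B =
    \<lparr>carrier = (\<Pi>\<^sub>E i\<in>I. carrier (B i)),
     monoid.mult = (\<lambda>x y. \<lambda>i\<in>I. x i \<otimes>\<^bsub>B i\<^esub> y i),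
     monoid.one = (\<lambda>i\<in>I. \<one>\<^bsub>B i\<^esub>),
     ring.zero = (\<lambda>i\<in>I. \<zero>\<^bsub>B i\<^esub>),
     ring.add = (\<lambda>x y. \<lambda>i\<in>I. x i \<oplus>\<^bsub>B i\<^esub> y i),
     module.smult = (\<lambda>c x. \<lambda>i\<in>I. c \<odot>\<^bsub>B i\<^esub> x i)\<rparr>"

definition algebra_isomorphic ::
  "('f, 'k) ring_scheme \<Rightarrow> ('f, 'a, 'm) module_scheme \<Rightarrow> ('f, 'b, 'n) module_scheme \<Rightarrow> bool" where
  "algebra_isomorphic F A B \<longleftrightarrow>
    (\<exists>\<phi>. \<phi> \<in> module_hom F A B \<and> bij_betw \<phi> (carrier A) (carrier B) \<and>
      (\<forall>a\<in>carrier A. \<forall>b\<in>carrier A. \<phi> (a \<otimes>\<^bsub>A\<^esub> b) = \<phi> a \<otimes>\<^bsub>B\<^esub> \<phi> b))"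

definition semiprime :: "('f, 'a, 'm) module_scheme \<Rightarrow> bool" where
  "semiprime A \<longleftrightarrow>
    (\<forall>a\<in>carrier A. {a \<otimes>\<^bsub>A\<^esub> x \<otimes>\<^bsub>A\<^esub> a | x. x \<in> carrier A} = {\<zero>\<^bsub>A\<^esub>} \<longrightarrow> a = \<zero>\<^bsub>A\<^esub>)"

text \<open>\<open>r\<close>, \<open>n\<close>, \<open>D\<close> exhibit \<open>A\<close> as a direct product of matrix algebras over division algebras;
  the factors are indexed by \<open>0, \<dots>, r - 1\<close>. The \<open>D i\<close> are carrier-based, so they may be pairwise
  non-isomorphic although their elements have one common type.\<close>

definition matrix_decomposition ::
  "('f, 'k) ring_scheme \<Rightarrow> ('f, 'a, 'm) module_scheme \<Rightarrow>
    nat \<Rightarrow> (nat \<Rightarrow> nat) \<Rightarrow> (nat \<Rightarrow> ('f, 'd, 'n) module_scheme) \<Rightarrow> bool" where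
  "matrix_decomposition F A r n D \<longleftrightarrow>
    r \<ge> 1 \<and> (\<forall>i<r. n i \<ge> 1 \<and> division_algebra F (D i)) \<and>
    algebra_isomorphic F A (product_algebra {..<r} (\<lambda>i. matrix_algebra (n i) (D i)))"

end

theory Submission
  imports Defs
begin

text \<open>In a semiprime finite dimensional algebra every nonzero left ideal contains an idempotent \<open>f\<close>
  with \<open>f A f\<close> a division algebra. Take a finite family of orthogonal idempotents of this kind
  with sum \<open>s\<close> for which the left ideal of all \<open>x\<close> with \<open>x s = 0\<close> is minimal. This left ideal must
  vanish, since otherwise an idempotent inside it enlarges the family. Hence \<open>x s = x\<close> for all \<open>x\<close>,
  and semiprimeness makes \<open>s\<close> a two-sided unity. Call \<open>e\<close> and \<open>f\<close> of the family equivalent if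
  \<open>e A f\<close> is nonzero; then there are \<open>u \<in> e A f\<close> and \<open>v \<in> f A e\<close> with \<open>u v = e\<close> and \<open>v u = f\<close>.
  For a class with chosen representative \<open>p\<close> and members \<open>e_i = u_i v_i\<close>, \<open>v_i u_i = p\<close>, the entries
  \<open>v_i a u_j\<close> form a matrix over \<open>p A p\<close>, and sending \<open>a\<close> to these matrices, one for each class,
  is the required isomorphism. Conversely, an entry \<open>m\<close> at \<open>(i, j)\<close> of a matrix \<open>M\<close> reappears as
  \<open>m m\<close> in \<open>M E M\<close>, with \<open>E\<close> the matrix unit at \<open>(j, i)\<close>.\<close>

section \<open>Minimal members of a family of subspaces\<close>

text \<open>Strict inclusion raises the largest size \<open>d W\<close> of a finite independent
  subset, so a member of \<open>S\<close> with least \<open>d\<close> is minimal. Counting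
  independent sets inside \<open>V\<close> avoids a separate vector space for each
  \<open>W\<close>.\<close>

lemma (in vectorspace) exists_minimal_submodule:
  assumes "fin_dim" and "S \<noteq> {}" and sub: "\<And>W. W \<in> S \<Longrightarrow> submodule K W V"
  obtains W where "W \<in> S" "\<And>U. U \<in> S \<Longrightarrow> U \<subseteq> W \<Longrightarrow> U = W"
proof -
  define P where "P W n \<longleftrightarrow> (\<exists>B. B \<subseteq> W \<and> lin_indpt B \<and> finite B \<and> card B = n)" for W n
  define d where "d W = (GREATEST n. P W n)" for W
  have bound: "n \<le> dim" if "P W n" "W \<in> S" for W n
  proof -
    have "W \<subseteq> carrier V"
      using sub[OF that(2)] by (rule submodule.subset)
    with that(1) show ?thesis
      using li_le_dim(2)[OF \<open>fin_dim\<close>] by (auto simp: P_def)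
  qed
  \<comment> \<open>With \<open>bound\<close> this makes \<open>GREATEST\<close> meaningful: zero
    occurs among the sizes, and they are bounded.\<close>
  have empty: "P W 0" for W
    unfolding P_def by (rule exI[of _ "{}"]) (auto simp: lin_dep_def)
  have less: "d U < d W" if U: "U \<in> S" and W: "W \<in> S" and UW: "U \<subset> W" for U W
  proof -
    have "P U (d U)"
      unfolding d_def by (rule GreatestI_nat[of "P U" 0 dim]) (use bound U empty in auto)
    then obtain B where B: "B \<subseteq> U" "lin_indpt B" "finite B" "card B = d U"
      by (auto simp: P_def)
    obtain w where w: "w \<in> W" "w \<notin> U"
      using UW by auto
    interpret U: submodule K U V using sub[OF U] .
    interpret W: submodule K W V using sub[OF W] .
    \<comment> \<open>A largest independent set of \<open>U\<close> spans only elements of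
      \<open>U\<close>, so any \<open>w\<close> outside \<open>U\<close> enlarges it.\<close>
    have "span B \<subseteq> U"
      using B(1) sub[OF U] by (rule span_is_subset)
    then have "lin_indpt (B \<union> {w})"
      using lin_dep_iff_in_span[of B w] B w U.subset W.subset by blast
    then have "P W (Suc (d U))"
      unfolding P_def using B w UW by (intro exI[of _ "B \<union> {w}"]) (auto simp: card_insert_if)
    then have "Suc (d U) \<le> d W"
      unfolding d_def[of W] by (rule Greatest_le_nat) (use bound W in auto)
    then show ?thesis by simp
  qed
  obtain W0 where "W0 \<in> S" using \<open>S \<noteq> {}\<close> by blast
  then obtain W where W: "W \<in> S" "\<And>U. U \<in> S \<Longrightarrow> d W \<le> d U"
    using ex_has_least_nat[of "\<lambda>W. W \<in> S" W0 d] by blast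
  show thesis
    by (rule that[of W]) (use W less in \<open>force simp: psubset_eq\<close>)+
qed

text \<open>The set equation in \<open>semiprime\<close> also claims that its left side is nonempty;
  \<open>a\<close> itself serves as the required \<open>x\<close>. Stated for bare records, this
  also fits products and matrix algebras.\<close>

lemma semiprime_iff:
  "semiprime A \<longleftrightarrow>
    (\<forall>a\<in>carrier A. (\<forall>x\<in>carrier A. a \<otimes>\<^bsub>A\<^esub> x \<otimes>\<^bsub>A\<^esub> a = \<zero>\<^bsub>A\<^esub>) \<longrightarrow> a = \<zero>\<^bsub>A\<^esub>)"
proof -
  have "{a \<otimes>\<^bsub>A\<^esub> x \<otimes>\<^bsub>A\<^esub> a | x. x \<in> carrier A} = {\<zero>\<^bsub>A\<^esub>} \<longleftrightarrow>
    (\<forall>x\<in>carrier A. a \<otimes>\<^bsub>A\<^esub> x \<otimes>\<^bsub>A\<^esub> a = \<zero>\<^bsub>A\<^esub>)" if "a \<in> carrier A" for a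
    using that by (auto simp: set_eq_iff intro: exI[of _ a])
  then show ?thesis by (auto simp: semiprime_def)
qed

section \<open>Arithmetic with zero, differences and sums\<close>

context assoc_algebra
begin

abbreviation mul (infixl \<open>\<star>\<close> 70) where "x \<star> y \<equiv> x \<otimes>\<^bsub>A\<^esub> y"

lemma mult_zero_left [simp]:
  assumes "x \<in> carrier A" shows "\<zero>\<^bsub>A\<^esub> \<star> x = \<zero>\<^bsub>A\<^esub>"
proof -
  have "\<zero>\<^bsub>A\<^esub> \<star> x \<oplus>\<^bsub>A\<^esub> \<zero>\<^bsub>A\<^esub> \<star> x = \<zero>\<^bsub>A\<^esub> \<star> x"
    using mult_add_left[of "\<zero>\<^bsub>A\<^esub>" "\<zero>\<^bsub>A\<^esub>" x] assms by simp
  then show ?thesis using assms by (simp add: mult_closed)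
qed

lemma mult_zero_right [simp]:
  assumes "x \<in> carrier A" shows "x \<star> \<zero>\<^bsub>A\<^esub> = \<zero>\<^bsub>A\<^esub>"
proof -
  have "x \<star> \<zero>\<^bsub>A\<^esub> \<oplus>\<^bsub>A\<^esub> x \<star> \<zero>\<^bsub>A\<^esub> = x \<star> \<zero>\<^bsub>A\<^esub>"
    using mult_add_right[of x "\<zero>\<^bsub>A\<^esub>" "\<zero>\<^bsub>A\<^esub>"] assms by simp
  then show ?thesis using assms by (simp add: mult_closed)
qed

lemma mult_diff_left:
  assumes "x \<in> carrier A" "y \<in> carrier A" "z \<in> carrier A"
  shows "(x \<ominus>\<^bsub>A\<^esub> y) \<star> z = x \<star> z \<ominus>\<^bsub>A\<^esub> y \<star> z"
proof -
  have "(x \<ominus>\<^bsub>A\<^esub> y) \<star> z \<oplus>\<^bsub>A\<^esub> y \<star> z = ((x \<ominus>\<^bsub>A\<^esub> y) \<oplus>\<^bsub>A\<^esub> y) \<star> z"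
    using assms by (simp add: mult_add_left)
  also have "(x \<ominus>\<^bsub>A\<^esub> y) \<oplus>\<^bsub>A\<^esub> y = x"
    using assms by (simp add: a_minus_def M.a_assoc M.l_neg)
  finally show ?thesis
    using assms by (metis M.add.inv_solve_right M.minus_closed a_minus_def mult_closed)
qed

lemma mult_diff_right:
  assumes "x \<in> carrier A" "y \<in> carrier A" "z \<in> carrier A"
  shows "z \<star> (x \<ominus>\<^bsub>A\<^esub> y) = z \<star> x \<ominus>\<^bsub>A\<^esub> z \<star> y"
proof -
  have "z \<star> (x \<ominus>\<^bsub>A\<^esub> y) \<oplus>\<^bsub>A\<^esub> z \<star> y = z \<star> ((x \<ominus>\<^bsub>A\<^esub> y) \<oplus>\<^bsub>A\<^esub> y)"
    using assms by (simp add: mult_add_right)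
  also have "(x \<ominus>\<^bsub>A\<^esub> y) \<oplus>\<^bsub>A\<^esub> y = x"
    using assms by (simp add: a_minus_def M.a_assoc M.l_neg)
  finally show ?thesis
    using assms by (metis M.add.inv_solve_right M.minus_closed a_minus_def mult_closed)
qed

lemma diff_eq_zero_iff:
  "x \<in> carrier A \<Longrightarrow> y \<in> carrier A \<Longrightarrow> x \<ominus>\<^bsub>A\<^esub> y = \<zero>\<^bsub>A\<^esub> \<longleftrightarrow> x = y"
  by (metis M.add.inv_closed M.minus_equality M.r_neg a_minus_def M.minus_minus)

lemma mult_finsum_left:
  assumes "finite I" "x \<in> carrier A" "f \<in> I \<rightarrow> carrier A"
  shows "(\<Oplus>\<^bsub>A\<^esub>i\<in>I. f i) \<star> x = (\<Oplus>\<^bsub>A\<^esub>i\<in>I. f i \<star> x)"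
  using assms by (induction I rule: finite_induct) (simp_all add: Pi_def mult_add_left mult_closed)

lemma mult_finsum_right:
  assumes "finite I" "x \<in> carrier A" "f \<in> I \<rightarrow> carrier A"
  shows "x \<star> (\<Oplus>\<^bsub>A\<^esub>i\<in>I. f i) = (\<Oplus>\<^bsub>A\<^esub>i\<in>I. x \<star> f i)"
  using assms by (induction I rule: finite_induct) (simp_all add: Pi_def mult_add_right mult_closed)

section \<open>Left ideals and division idempotents\<close>

text \<open>Without a unity, closure under left multiplication need not give closure under scalars,
  hence the subspace condition.\<close>

definition left_ideal :: "'c set \<Rightarrow> bool" where
  "left_ideal L \<longleftrightarrow> submodule F L A \<and> (\<forall>a\<in>carrier A. \<forall>x\<in>L. a \<star> x \<in> L)"

definition minimal_left_ideal :: "'c set \<Rightarrow> bool" where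
  "minimal_left_ideal L \<longleftrightarrow> left_ideal L \<and> L \<noteq> {\<zero>\<^bsub>A\<^esub>} \<and>
    (\<forall>K. left_ideal K \<longrightarrow> K \<subseteq> L \<longrightarrow> K \<noteq> {\<zero>\<^bsub>A\<^esub>} \<longrightarrow> K = L)"

text \<open>This says that \<open>e\<close> is an idempotent for which \<open>e A e\<close> is a
  division algebra with unity \<open>e\<close>. Only left inverses are demanded; they turn out to be
  two-sided.\<close>

definition division_idempotent :: "'c \<Rightarrow> bool" where
  "division_idempotent e \<longleftrightarrow> e \<in> carrier A \<and> e \<star> e = e \<and> e \<noteq> \<zero>\<^bsub>A\<^esub> \<and>
    (\<forall>a\<in>carrier A. e \<star> a \<star> e \<noteq> \<zero>\<^bsub>A\<^esub> \<longrightarrow>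
      (\<exists>b\<in>carrier A. (e \<star> b \<star> e) \<star> (e \<star> a \<star> e) = e))"

lemma left_idealI:
  assumes "L \<subseteq> carrier A" "\<zero>\<^bsub>A\<^esub> \<in> L"
    "\<And>x y. x \<in> L \<Longrightarrow> y \<in> L \<Longrightarrow> x \<oplus>\<^bsub>A\<^esub> y \<in> L"
    "\<And>c x. c \<in> carrier F \<Longrightarrow> x \<in> L \<Longrightarrow> c \<odot>\<^bsub>A\<^esub> x \<in> L"
    "\<And>a x. a \<in> carrier A \<Longrightarrow> x \<in> L \<Longrightarrow> a \<star> x \<in> L"
  shows "left_ideal L"
  unfolding left_ideal_def submodule_def using assms by (auto intro: module_axioms)

lemma left_idealD:
  assumes "left_ideal L"
  shows "L \<subseteq> carrier A" "\<zero>\<^bsub>A\<^esub> \<in> L"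
    "\<And>x y. x \<in> L \<Longrightarrow> y \<in> L \<Longrightarrow> x \<oplus>\<^bsub>A\<^esub> y \<in> L"
    "\<And>c x. c \<in> carrier F \<Longrightarrow> x \<in> L \<Longrightarrow> c \<odot>\<^bsub>A\<^esub> x \<in> L"
    "\<And>a x. a \<in> carrier A \<Longrightarrow> x \<in> L \<Longrightarrow> a \<star> x \<in> L"
  using assms unfolding left_ideal_def submodule_def by auto

text \<open>Right multiplication by \<open>y\<close> commutes with left multiplications, so its
  image on \<open>L\<close>, and likewise its kernel in the next lemma, is a left ideal.\<close>

lemma left_ideal_mult_image:
  assumes "left_ideal L" "y \<in> carrier A"
  shows "left_ideal ((\<lambda>x. x \<star> y) ` L)"
proof (rule left_idealI)
  note L = left_idealD[OF assms(1)]
  show "(\<lambda>x. x \<star> y) ` L \<subseteq> carrier A"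
    using L assms(2) by (auto simp: mult_closed)
  show "\<zero>\<^bsub>A\<^esub> \<in> (\<lambda>x. x \<star> y) ` L"
    using L(2) assms(2) by (intro image_eqI[of _ _ "\<zero>\<^bsub>A\<^esub>"]) auto
  show "u \<oplus>\<^bsub>A\<^esub> v \<in> (\<lambda>x. x \<star> y) ` L"
    if u: "u \<in> (\<lambda>x. x \<star> y) ` L" and v: "v \<in> (\<lambda>x. x \<star> y) ` L" for u v
  proof -
    obtain a b where "a \<in> L" "b \<in> L" "u = a \<star> y" "v = b \<star> y" using u v by auto
    then show ?thesis
      using L assms(2) by (intro image_eqI[of _ _ "a \<oplus>\<^bsub>A\<^esub> b"]) (auto simp: mult_add_left subset_iff)
  qed
  show "c \<odot>\<^bsub>A\<^esub> u \<in> (\<lambda>x. x \<star> y) ` L" if c: "c \<in> carrier F" and u: "u \<in> (\<lambda>x. x \<star> y) ` L" for c u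
  proof -
    obtain a where "a \<in> L" "u = a \<star> y" using u by auto
    then show ?thesis
      using L assms(2) c
      by (intro image_eqI[of _ _ "c \<odot>\<^bsub>A\<^esub> a"]) (auto simp: mult_smult_left subset_iff)
  qed
  show "b \<star> u \<in> (\<lambda>x. x \<star> y) ` L" if b: "b \<in> carrier A" and u: "u \<in> (\<lambda>x. x \<star> y) ` L" for b u
  proof -
    obtain a where "a \<in> L" "u = a \<star> y" using u by auto
    then show ?thesis
      using L assms(2) b
      by (intro image_eqI[of _ _ "b \<star> a"]) (auto simp: mult_assoc subset_iff)
  qed
qed

lemma left_ideal_annihilator:
  assumes "left_ideal L" "y \<in> carrier A"
  shows "left_ideal {x \<in> L. x \<star> y = \<zero>\<^bsub>A\<^esub>}"
proof -
  note L = left_idealD[OF assms(1)]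
  show ?thesis
    by (rule left_idealI)
      (use L assms(2) in \<open>auto simp: mult_add_left mult_smult_left mult_assoc subset_iff\<close>)
qed

lemma left_ideal_carrier: "left_ideal (carrier A)"
  by (rule left_idealI) (auto simp: mult_closed)

lemma semiprimeD:
  "semiprime A \<Longrightarrow> a \<in> carrier A \<Longrightarrow> (\<And>x. x \<in> carrier A \<Longrightarrow> a \<star> x \<star> a = \<zero>\<^bsub>A\<^esub>) \<Longrightarrow> a = \<zero>\<^bsub>A\<^esub>"
  by (auto simp: semiprime_iff)

lemma exists_minimal_left_ideal:
  assumes "fin_dim" "left_ideal L" "L \<noteq> {\<zero>\<^bsub>A\<^esub>}"
  obtains K where "minimal_left_ideal K" "K \<subseteq> L"
proof -
  define S where "S = {K. left_ideal K \<and> K \<subseteq> L \<and> K \<noteq> {\<zero>\<^bsub>A\<^esub>}}"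
  have ne: "S \<noteq> {}" using assms by (auto simp: S_def)
  have sub: "submodule F W A" if "W \<in> S" for W
    using that by (auto simp: S_def left_ideal_def)
  obtain K where "K \<in> S" "\<And>U. U \<in> S \<Longrightarrow> U \<subseteq> K \<Longrightarrow> U = K"
    using exists_minimal_submodule[OF assms(1) ne sub] by blast
  then show thesis
    by (intro that[of K]) (auto simp: S_def minimal_left_ideal_def)
qed

section \<open>Idempotents in minimal left ideals\<close>

text \<open>For nonzero \<open>c = e a e\<close>, the left ideal \<open>A c\<close> lies in
  \<open>L\<close> and contains \<open>c = e c\<close>. Minimality gives \<open>A c = L\<close>, so
  \<open>e = b c\<close> for some \<open>b\<close>, and \<open>e b e\<close> is the left inverse
  sought.\<close>

lemma minimal_left_ideal_division_idempotent:
  assumes min: "minimal_left_ideal L" and e: "e \<in> L" "e \<star> e = e" "e \<noteq> \<zero>\<^bsub>A\<^esub>"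
  shows "division_idempotent e"
proof -
  have L: "left_ideal L" using min by (simp add: minimal_left_ideal_def)
  have eA: "e \<in> carrier A" using left_idealD(1)[OF L] e by auto
  have "\<exists>b\<in>carrier A. (e \<star> b \<star> e) \<star> (e \<star> a \<star> e) = e"
    if a: "a \<in> carrier A" and nz: "e \<star> a \<star> e \<noteq> \<zero>\<^bsub>A\<^esub>" for a
  proof -
    let ?c = "e \<star> a \<star> e" and ?K = "(\<lambda>x. x \<star> (e \<star> a \<star> e)) ` carrier A"
    have c: "?c \<in> carrier A" using a eA by (simp add: mult_closed)
    have "?c \<in> L" using left_idealD(5)[OF L] a eA e by (simp add: mult_closed)
    then have "?K \<subseteq> L" using left_idealD(5)[OF L] by auto
    moreover have ec: "e \<star> ?c = ?c" using a eA e(2) by (simp add: mult_assoc[symmetric] mult_closed)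
    then have "?c \<in> ?K" using eA by (intro image_eqI[of _ _ e]) auto
    then have "?K \<noteq> {\<zero>\<^bsub>A\<^esub>}" using nz by auto
    ultimately have "?K = L"
      using min left_ideal_mult_image[OF left_ideal_carrier c] by (simp add: minimal_left_ideal_def)
    then obtain b where b: "b \<in> carrier A" "b \<star> ?c = e" using e(1) by auto
    have "(e \<star> b \<star> e) \<star> ?c = e \<star> (b \<star> (e \<star> ?c))"
      using b eA c by (simp add: mult_assoc mult_closed)
    then have "(e \<star> b \<star> e) \<star> ?c = e" using b e(2) ec by simp
    with b(1) show ?thesis by blast
  qed
  then show ?thesis using e eA by (simp add: division_idempotent_def)
qed

text \<open>Right multiplication by a suitable \<open>y\<close> in \<open>L\<close> maps
  \<open>L\<close> bijectively onto itself. An \<open>e\<close> in \<open>L\<close> with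
  \<open>e y = y\<close> then satisfies \<open>(e e - e) y = 0\<close>, which forces
  \<open>e e = e\<close>.\<close>

lemma minimal_left_ideal_has_idempotent:
  assumes "semiprime A" and min: "minimal_left_ideal L"
  obtains e where "e \<in> L" "e \<star> e = e" "e \<noteq> \<zero>\<^bsub>A\<^esub>"
proof -
  have L: "left_ideal L" using min by (simp add: minimal_left_ideal_def)
  note LD = left_idealD[OF L]
  obtain a where a: "a \<in> L" "a \<noteq> \<zero>\<^bsub>A\<^esub>"
    using min LD(2) by (auto simp: minimal_left_ideal_def)
  then have "\<exists>x\<in>carrier A. a \<star> x \<star> a \<noteq> \<zero>\<^bsub>A\<^esub>"
    using semiprimeD[OF assms(1)] LD(1) by blast
  then obtain x where x: "x \<in> carrier A" "a \<star> x \<star> a \<noteq> \<zero>\<^bsub>A\<^esub>" by blast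
  \<comment> \<open>The factor \<open>a\<close> on the right puts \<open>y\<close> in
    \<open>L\<close>, and \<open>a y\<close> is nonzero by the choice of \<open>x\<close>.\<close>
  define y where "y = x \<star> a"
  have y: "y \<in> L" "y \<in> carrier A" using LD a(1) x(1) by (auto simp: y_def)
  have ay: "a \<star> y \<noteq> \<zero>\<^bsub>A\<^esub>" using a x LD(1) by (auto simp: y_def mult_assoc subset_iff)
  have "(\<lambda>z. z \<star> y) ` L \<noteq> {\<zero>\<^bsub>A\<^esub>}" using ay a(1) by auto
  moreover have "(\<lambda>z. z \<star> y) ` L \<subseteq> L" using LD y(1) by auto
  ultimately have "(\<lambda>z. z \<star> y) ` L = L"
    using min left_ideal_mult_image[OF L y(2)] by (simp add: minimal_left_ideal_def)
  then have "y \<in> (\<lambda>z. z \<star> y) ` L" using y(1) by simp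
  then obtain e where e: "e \<in> L" "e \<star> y = y" unfolding image_iff by metis
  have eA: "e \<in> carrier A" using e LD by auto
  let ?N = "{z \<in> L. z \<star> y = \<zero>\<^bsub>A\<^esub>}"
  \<comment> \<open>The kernel of multiplication by \<open>y\<close> on \<open>L\<close> misses
    \<open>a\<close>, so minimality leaves only zero.\<close>
  have "?N = {\<zero>\<^bsub>A\<^esub>}"
  proof (rule ccontr)
    assume "?N \<noteq> {\<zero>\<^bsub>A\<^esub>}"
    then have "?N = L"
      using min left_ideal_annihilator[OF L y(2)] by (auto simp: minimal_left_ideal_def)
    then show False using a(1) ay by auto
  qed
  \<comment> \<open>Closure of \<open>L\<close> under negation comes from the scalar
    \<open>-1\<close>.\<close>
  moreover have "e \<star> e \<ominus>\<^bsub>A\<^esub> e \<in> L"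
  proof -
    have "\<ominus>\<^bsub>F\<^esub> \<one>\<^bsub>F\<^esub> \<odot>\<^bsub>A\<^esub> e \<in> L" using LD e by auto
    then show ?thesis using LD(3,5) e eA by (simp add: a_minus_def smult_minus_1_back)
  qed
  moreover have "(e \<star> e \<ominus>\<^bsub>A\<^esub> e) \<star> y = \<zero>\<^bsub>A\<^esub>"
    using e eA y by (simp add: mult_diff_left mult_closed mult_assoc diff_eq_zero_iff)
  ultimately have "e \<star> e \<ominus>\<^bsub>A\<^esub> e = \<zero>\<^bsub>A\<^esub>" by blast
  then have "e \<star> e = e" using eA by (simp add: diff_eq_zero_iff mult_closed)
  moreover have "e \<noteq> \<zero>\<^bsub>A\<^esub>" using e(2) y(2) ay a(1) LD(1) by (auto simp: subset_iff)
  ultimately show thesis using that e by blast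
qed

lemma division_idempotentD:
  assumes "division_idempotent e"
  shows "e \<in> carrier A" "e \<star> e = e" "e \<noteq> \<zero>\<^bsub>A\<^esub>"
  using assms by (auto simp: division_idempotent_def)

text \<open>Left inverses exist for all nonzero elements of \<open>e A e\<close>: \<open>b\<close>
  for \<open>a\<close>, then \<open>c\<close> for \<open>b\<close>. Hence
  \<open>a = c b a = c\<close>, which makes \<open>b\<close> a two-sided inverse.\<close>

lemma division_idempotent_inverse:
  assumes e: "division_idempotent e"
    and a: "a \<in> carrier A" "e \<star> a = a" "a \<star> e = a" "a \<noteq> \<zero>\<^bsub>A\<^esub>"
  obtains b where "b \<in> carrier A" "e \<star> b = b" "b \<star> e = b" "b \<star> a = e" "a \<star> b = e"
proof -
  note eD = division_idempotentD[OF e]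
  have inv: "\<exists>b\<in>carrier A. e \<star> b = b \<and> b \<star> e = b \<and> b \<star> a = e"
    if a: "a \<in> carrier A" "e \<star> a = a" "a \<star> e = a" "a \<noteq> \<zero>\<^bsub>A\<^esub>" for a
  proof -
    have eae: "e \<star> a \<star> e = a" using a by simp
    then obtain b where b: "b \<in> carrier A" "(e \<star> b \<star> e) \<star> a = e"
      using e a unfolding division_idempotent_def by metis
    show ?thesis
    proof (intro bexI[of _ "e \<star> b \<star> e"] conjI)
      show "e \<star> (e \<star> b \<star> e) = e \<star> b \<star> e"
        using eD b(1) by (simp add: mult_assoc[symmetric] mult_closed)
      show "e \<star> b \<star> e \<star> e = e \<star> b \<star> e"
        using eD b(1) by (simp add: mult_assoc mult_closed)
    qed (use b eD in \<open>auto simp: mult_closed\<close>)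
  qed
  obtain b where b: "b \<in> carrier A" "e \<star> b = b" "b \<star> e = b" "b \<star> a = e"
    using inv[OF a] by blast
  have "b \<noteq> \<zero>\<^bsub>A\<^esub>" using b(4) a(1) eD(3) by auto
  then obtain c where c: "c \<in> carrier A" "c \<star> e = c" "c \<star> b = e"
    using inv[of b] b by blast
  have "a = c \<star> b \<star> a" using a c by simp
  also have "\<dots> = c \<star> (b \<star> a)" by (rule mult_assoc[OF c(1) b(1) a(1)])
  also have "\<dots> = c" using b c by simp
  finally show thesis using that b c by blast
qed

section \<open>Orthogonal families and the unity\<close>

definition orthogonal_family :: "'c set \<Rightarrow> bool" where
  "orthogonal_family E \<longleftrightarrow> finite E \<and> (\<forall>e\<in>E. division_idempotent e) \<and>
    (\<forall>e\<in>E. \<forall>f\<in>E. e \<noteq> f \<longrightarrow> e \<star> f = \<zero>\<^bsub>A\<^esub>)"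

lemma orthogonal_family_carrier: "orthogonal_family E \<Longrightarrow> E \<subseteq> carrier A"
  by (auto simp: orthogonal_family_def division_idempotent_def)

lemma orthogonal_family_sum:
  assumes E: "orthogonal_family E"
  defines "s \<equiv> \<Oplus>\<^bsub>A\<^esub>e\<in>E. e"
  shows "s \<in> carrier A" "\<And>e. e \<in> E \<Longrightarrow> e \<star> s = e" "\<And>e. e \<in> E \<Longrightarrow> s \<star> e = e" "s \<star> s = s"
proof -
  have fin: "finite E" and sub: "E \<subseteq> carrier A" and idem: "\<And>e. e \<in> E \<Longrightarrow> e \<star> e = e"
    and ort: "\<And>e f. e \<in> E \<Longrightarrow> f \<in> E \<Longrightarrow> e \<noteq> f \<Longrightarrow> e \<star> f = \<zero>\<^bsub>A\<^esub>"
    using E orthogonal_family_carrier[OF E]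
    by (auto simp: orthogonal_family_def division_idempotent_def)
  have id: "(\<lambda>e. e) \<in> E \<rightarrow> carrier A" using sub by auto
  show s: "s \<in> carrier A" using id by (simp add: s_def)
  show es: "e \<star> s = e" if e: "e \<in> E" for e
  proof -
    have "e \<star> s = (\<Oplus>\<^bsub>A\<^esub>f\<in>E. e \<star> f)"
      using mult_finsum_right[OF fin _ id] e sub by (auto simp: s_def)
    also have "\<dots> = (\<Oplus>\<^bsub>A\<^esub>f\<in>E. if e = f then f else \<zero>\<^bsub>A\<^esub>)"
      using e sub idem ort by (intro M.finsum_cong') auto
    also have "\<dots> = e"
      by (rule M.finsum_singleton) (use e fin sub in auto)
    finally show ?thesis .
  qed
  show "s \<star> e = e" if e: "e \<in> E" for e
  proof -
    have "s \<star> e = (\<Oplus>\<^bsub>A\<^esub>f\<in>E. f \<star> e)"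
      using mult_finsum_left[OF fin _ id] e sub by (auto simp: s_def)
    also have "\<dots> = (\<Oplus>\<^bsub>A\<^esub>f\<in>E. if e = f then f else \<zero>\<^bsub>A\<^esub>)"
      using e sub idem ort by (intro M.finsum_cong') auto
    also have "\<dots> = e"
      by (rule M.finsum_singleton) (use e fin sub in auto)
    finally show ?thesis .
  qed
  have "s \<star> s = (\<Oplus>\<^bsub>A\<^esub>f\<in>E. f \<star> s)"
    using mult_finsum_left[OF fin s id] by (simp add: s_def)
  also have "\<dots> = s"
    unfolding s_def by (rule M.finsum_cong') (use es sub in \<open>auto simp: s_def\<close>)
  finally show "s \<star> s = s" .
qed

text \<open>Correcting the idempotent \<open>g\<close> of a minimal left ideal annihilated by \<open>s\<close> to
  \<open>g - s g\<close> makes it orthogonal to \<open>s\<close> on both sides.\<close>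

lemma extend_orthogonal_family:
  assumes "fin_dim" and semi: "semiprime A" and E: "orthogonal_family E"
  defines "s \<equiv> \<Oplus>\<^bsub>A\<^esub>e\<in>E. e"
  assumes x: "x \<in> carrier A" "x \<star> s = \<zero>\<^bsub>A\<^esub>" "x \<noteq> \<zero>\<^bsub>A\<^esub>"
  obtains f where "f \<notin> E" "orthogonal_family (insert f E)" "f \<star> s = \<zero>\<^bsub>A\<^esub>" "s \<star> f = \<zero>\<^bsub>A\<^esub>"
proof -
  note S = orthogonal_family_sum[OF E, folded s_def]
  let ?L = "{x \<in> carrier A. x \<star> s = \<zero>\<^bsub>A\<^esub>}"
  have "left_ideal ?L" by (rule left_ideal_annihilator[OF left_ideal_carrier S(1)])
  moreover have "?L \<noteq> {\<zero>\<^bsub>A\<^esub>}" using x by auto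
  ultimately obtain K where K: "minimal_left_ideal K" "K \<subseteq> ?L"
    using exists_minimal_left_ideal[OF \<open>fin_dim\<close>] by metis
  have KI: "left_ideal K" using K by (simp add: minimal_left_ideal_def)
  note KD = left_idealD[OF KI]
  obtain g where g: "g \<in> K" "g \<star> g = g" "g \<noteq> \<zero>\<^bsub>A\<^esub>"
    using minimal_left_ideal_has_idempotent[OF semi K(1)] by blast
  have gA: "g \<in> carrier A" and gs: "g \<star> s = \<zero>\<^bsub>A\<^esub>" using g K by auto
  define f where "f = g \<ominus>\<^bsub>A\<^esub> s \<star> g"
  have sg: "s \<star> g \<in> carrier A" using S gA by (simp add: mult_closed)
  have fA: "f \<in> carrier A" using gA sg by (simp add: f_def)
  have sf: "s \<star> f = \<zero>\<^bsub>A\<^esub>"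
    using S gA sg by (simp add: f_def mult_diff_right mult_assoc[symmetric] diff_eq_zero_iff)
  have fs: "f \<star> s = \<zero>\<^bsub>A\<^esub>"
    using S gA sg gs by (simp add: f_def mult_diff_left mult_assoc diff_eq_zero_iff)
  \<comment> \<open>Since \<open>g s = 0\<close>, the correction \<open>s g\<close> does not affect
    \<open>g f = g g\<close>. This gives both \<open>f f = g f - s g f = f\<close> and that
    \<open>f\<close> is nonzero.\<close>
  have gf: "g \<star> f = g"
  proof -
    have "g \<star> f = g \<ominus>\<^bsub>A\<^esub> \<zero>\<^bsub>A\<^esub>"
      using S gA sg gs g by (simp add: f_def mult_diff_right mult_assoc[symmetric])
    then show ?thesis using gA by (simp add: a_minus_def)
  qed
  have "f \<star> f = g \<star> f \<ominus>\<^bsub>A\<^esub> s \<star> (g \<star> f)"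
    using mult_diff_left[OF gA sg fA] mult_assoc[OF S(1) gA fA] by (simp add: f_def[symmetric])
  then have "f \<star> f = g \<ominus>\<^bsub>A\<^esub> s \<star> g" by (simp only: gf)
  then have "f \<star> f = f" by (simp only: f_def[symmetric])
  moreover have "f \<noteq> \<zero>\<^bsub>A\<^esub>" using gf gA g by auto
  moreover have "f \<in> K"
  proof -
    have "\<ominus>\<^bsub>F\<^esub> \<one>\<^bsub>F\<^esub> \<odot>\<^bsub>A\<^esub> (s \<star> g) \<in> K" using KD g S by auto
    then show ?thesis using KD(3) g sg by (simp add: f_def a_minus_def smult_minus_1_back)
  qed
  ultimately have div: "division_idempotent f"
    using minimal_left_ideal_division_idempotent[OF K(1)] by blast
  note EA = orthogonal_family_carrier[OF E]
  have ef: "e \<star> f = \<zero>\<^bsub>A\<^esub> \<and> f \<star> e = \<zero>\<^bsub>A\<^esub>" if e: "e \<in> E" for e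
  proof
    have eA: "e \<in> carrier A" using e EA by auto
    have "e \<star> f = e \<star> (s \<star> f)" using S e eA fA by (simp add: mult_assoc[symmetric])
    then show "e \<star> f = \<zero>\<^bsub>A\<^esub>" using sf eA by simp
    have "f \<star> e = (f \<star> s) \<star> e" using S e eA fA by (simp add: mult_assoc)
    then show "f \<star> e = \<zero>\<^bsub>A\<^esub>" using fs eA by simp
  qed
  \<comment> \<open>If \<open>f\<close> were in \<open>E\<close>, the fact \<open>ef\<close> with
    \<open>e = f\<close> would give \<open>f f = 0\<close>.\<close>
  have "f \<notin> E" using ef division_idempotentD[OF div] by auto
  moreover have "orthogonal_family (insert f E)"
    using E div ef by (auto simp: orthogonal_family_def)
  ultimately show thesis using that fs sf by blast
qed

lemma exists_complete_orthogonal_family: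
  assumes "fin_dim" and semi: "semiprime A"
  obtains E where "orthogonal_family E"
    "\<And>x. x \<in> carrier A \<Longrightarrow> (\<Oplus>\<^bsub>A\<^esub>e\<in>E. e) \<star> x = x"
    "\<And>x. x \<in> carrier A \<Longrightarrow> x \<star> (\<Oplus>\<^bsub>A\<^esub>e\<in>E. e) = x"
proof -
  define s where "s E = (\<Oplus>\<^bsub>A\<^esub>e\<in>E. e)" for E
  \<comment> \<open>Minimality is sought among the annihilators \<open>N E\<close>, which are
    subspaces, rather than among the families.\<close>
  define N where "N E = {x \<in> carrier A. x \<star> s E = \<zero>\<^bsub>A\<^esub>}" for E
  have "orthogonal_family {}" by (simp add: orthogonal_family_def)
  then have ne: "N ` Collect orthogonal_family \<noteq> {}" by auto
  have sub: "submodule F W A" if W: "W \<in> N ` Collect orthogonal_family" for W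
  proof -
    obtain E where E: "W = N E" "orthogonal_family E" using W by auto
    have "left_ideal (N E)"
      unfolding N_def using orthogonal_family_sum(1)[OF E(2)]
      by (intro left_ideal_annihilator left_ideal_carrier) (simp add: s_def)
    then show ?thesis by (simp add: E left_ideal_def)
  qed
  obtain E where E: "orthogonal_family E"
    and min: "\<And>E'. orthogonal_family E' \<Longrightarrow> N E' \<subseteq> N E \<Longrightarrow> N E' = N E"
    using exists_minimal_submodule[OF \<open>fin_dim\<close> ne sub] by (smt (verit) image_iff mem_Collect_eq)
  note S = orthogonal_family_sum[OF E, folded s_def]
  note EA = orthogonal_family_carrier[OF E]
  have N0: "x = \<zero>\<^bsub>A\<^esub>" if x: "x \<in> carrier A" "x \<star> s E = \<zero>\<^bsub>A\<^esub>" for x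
  proof (rule ccontr)
    assume nz: "x \<noteq> \<zero>\<^bsub>A\<^esub>"
    obtain f where f: "f \<notin> E" "orthogonal_family (insert f E)"
      "f \<star> s E = \<zero>\<^bsub>A\<^esub>" "s E \<star> f = \<zero>\<^bsub>A\<^esub>"
      using extend_orthogonal_family[OF \<open>fin_dim\<close> semi E, folded s_def, OF x nz] .
    have fA: "f \<in> carrier A" using orthogonal_family_carrier[OF f(2)] by auto
    have sf: "s (insert f E) = f \<oplus>\<^bsub>A\<^esub> s E"
      unfolding s_def using E f(1) EA fA
      by (intro M.finsum_insert) (auto simp: orthogonal_family_def)
    \<comment> \<open>Multiplying \<open>y (f + s) = 0\<close> by \<open>s\<close> on the right
      removes \<open>f\<close>, because \<open>f s = 0\<close>.\<close>
    have "N (insert f E) \<subseteq> N E"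
    proof
      fix y assume "y \<in> N (insert f E)"
      then have y: "y \<in> carrier A" "y \<star> (f \<oplus>\<^bsub>A\<^esub> s E) = \<zero>\<^bsub>A\<^esub>" by (auto simp: N_def sf)
      have "y \<star> s E = y \<star> ((f \<oplus>\<^bsub>A\<^esub> s E) \<star> s E)"
        using S(1,4) fA f by (simp add: mult_add_left)
      also have "\<dots> = \<zero>\<^bsub>A\<^esub>"
        using y S(1,4) fA by (simp add: mult_assoc[symmetric])
      finally show "y \<in> N E" using y by (simp add: N_def)
    qed
    \<comment> \<open>\<open>f\<close> belongs to \<open>N E\<close>, but
      \<open>f (f + s) = f\<close> is nonzero, which contradicts minimality.\<close>
    then have "f \<in> N (insert f E)"
      using min[OF f(2)] f fA by (simp add: N_def)
    then have "f \<star> f = \<zero>\<^bsub>A\<^esub>"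
      using S(1,4) fA f by (simp add: N_def sf mult_add_right mult_closed)
    moreover have "division_idempotent f"
      using f(2) by (simp add: orthogonal_family_def)
    ultimately show False
      using division_idempotentD(2,3)[of f] by simp
  qed
  have right: "x \<star> s E = x" if x: "x \<in> carrier A" for x
  proof -
    have "x \<ominus>\<^bsub>A\<^esub> x \<star> s E = \<zero>\<^bsub>A\<^esub>"
      by (rule N0) (use x S(1,4) in \<open>simp_all add: mult_diff_left mult_closed mult_assoc diff_eq_zero_iff\<close>)
    then show ?thesis using x S(1,4) by (simp add: diff_eq_zero_iff mult_closed)
  qed
  have left: "s E \<star> x = x" if x: "x \<in> carrier A" for x
  proof -
    let ?c = "x \<ominus>\<^bsub>A\<^esub> s E \<star> x"
    have c: "?c \<in> carrier A" "s E \<star> ?c = \<zero>\<^bsub>A\<^esub>"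
      using x S(1,4) by (simp_all add: mult_diff_right mult_closed mult_assoc[symmetric] diff_eq_zero_iff)
    have "?c = \<zero>\<^bsub>A\<^esub>"
    proof (rule semiprimeD[OF semi c(1)])
      fix y assume y: "y \<in> carrier A"
      \<comment> \<open>Writing \<open>y\<close> as \<open>y s\<close> puts \<open>s\<close> in
        front of the second \<open>?c\<close>, which it annihilates.\<close>
      have "?c \<star> y \<star> ?c = ?c \<star> ((y \<star> s E) \<star> ?c)"
        using y c S(1,4) by (simp add: mult_assoc right mult_closed)
      also have "\<dots> = \<zero>\<^bsub>A\<^esub>"
        using y c S(1,4) by (simp only: mult_assoc mult_zero_right)
      finally show "?c \<star> y \<star> ?c = \<zero>\<^bsub>A\<^esub>" .
    qed
    then show ?thesis using x S(1,4) by (simp add: diff_eq_zero_iff mult_closed)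
  qed
  show thesis using that[OF E] left right by (simp add: s_def)
qed

section \<open>Equivalence of division idempotents\<close>

text \<open>Such \<open>u\<close>, \<open>v\<close> are the mutually inverse isomorphisms between the left ideals \<open>A e\<close> and \<open>A f\<close>,
  given by right multiplication.\<close>

definition equivalent_via :: "'c \<Rightarrow> 'c \<Rightarrow> 'c \<Rightarrow> 'c \<Rightarrow> bool" where
  "equivalent_via e f u v \<longleftrightarrow> u \<in> carrier A \<and> v \<in> carrier A \<and> u \<star> v = e \<and> v \<star> u = f \<and>
    e \<star> u = u \<and> u \<star> f = u \<and> f \<star> v = v \<and> v \<star> e = v"

text \<open>The inner products collapse: \<open>u x y v = u f v = e\<close> and
  \<open>y v u x = y f x = g\<close>.\<close>

lemma equivalent_via_trans:
  assumes "equivalent_via e f u v" "equivalent_via f g x y"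
  shows "equivalent_via e g (u \<star> x) (y \<star> v)"
proof -
  have a: "u \<in> carrier A" "v \<in> carrier A" "u \<star> v = e" "v \<star> u = f"
    "e \<star> u = u" "u \<star> f = u" "f \<star> v = v" "v \<star> e = v"
    "x \<in> carrier A" "y \<in> carrier A" "x \<star> y = f" "y \<star> x = g"
    "f \<star> x = x" "x \<star> g = x" "g \<star> y = y" "y \<star> f = y"
    using assms by (auto simp: equivalent_via_def)
  have "u \<star> x \<star> (y \<star> v) = u \<star> (x \<star> y) \<star> v" "y \<star> v \<star> (u \<star> x) = y \<star> (v \<star> u) \<star> x"
    using a(1,2,9,10) by (simp_all add: mult_assoc mult_closed)
  moreover have "e \<in> carrier A" "g \<in> carrier A" using a by (auto simp: mult_closed)
  ultimately show ?thesis
    using a unfolding equivalent_via_def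
    by (metis mult_assoc mult_closed)
qed

text \<open>Semiprimeness supplies \<open>y\<close> with \<open>u y u\<close> nonzero for
  \<open>u = e x f\<close>. Inverting \<open>u y e\<close> in \<open>e A e\<close> gives
  \<open>v\<close> with \<open>u v = e\<close>; then \<open>v u\<close> is a nonzero idempotent of
  the division algebra \<open>f A f\<close>, hence equals \<open>f\<close>.\<close>

lemma equivalent_via_if_nonzero:
  assumes semi: "semiprime A" and e: "division_idempotent e" and f: "division_idempotent f"
    and x: "x \<in> carrier A" "e \<star> x \<star> f \<noteq> \<zero>\<^bsub>A\<^esub>"
  obtains u v where "equivalent_via e f u v"
proof -
  note eD = division_idempotentD[OF e] and fD = division_idempotentD[OF f]
  let ?u = "e \<star> x \<star> f"
  have u: "?u \<in> carrier A" using eD fD x by (simp add: mult_closed)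
  have eu: "e \<star> ?u = ?u" using eD fD x by (simp add: mult_assoc[symmetric] mult_closed)
  have uf: "?u \<star> f = ?u" using eD fD x by (simp add: mult_assoc mult_closed)
  obtain y where y: "y \<in> carrier A" "?u \<star> y \<star> ?u \<noteq> \<zero>\<^bsub>A\<^esub>"
    using semiprimeD[OF semi u] x(2) by blast
  \<comment> \<open>The factor \<open>e\<close> moves \<open>u y\<close> into \<open>e A e\<close>;
    the result is nonzero because its product with \<open>u\<close> is \<open>u y u\<close>.\<close>
  let ?a = "?u \<star> y \<star> e"
  have a: "?a \<in> carrier A" using u y eD by (simp add: mult_closed)
  have "?a \<star> ?u = ?u \<star> y \<star> ?u" using u y eD eu by (simp add: mult_assoc mult_closed)
  then have "?a \<noteq> \<zero>\<^bsub>A\<^esub>" using u y(2) by auto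
  moreover have "e \<star> ?a = ?a" using eu u y eD by (metis mult_assoc mult_closed)
  moreover have "?a \<star> e = ?a" using u y eD by (simp add: mult_assoc mult_closed)
  ultimately obtain b where b: "b \<in> carrier A" "e \<star> b = b" "b \<star> e = b" "?a \<star> b = e"
    using division_idempotent_inverse[OF e a] by metis
  \<comment> \<open>\<open>u\<close> absorbs the factor \<open>f\<close>, and \<open>b = e b\<close>
    completes \<open>?a\<close>, so \<open>u v = u y e b = e\<close>.\<close>
  define v where "v = f \<star> y \<star> b"
  have v: "v \<in> carrier A" using fD y b by (simp add: v_def mult_closed)
  have fv: "f \<star> v = v" using fD y b by (simp add: v_def mult_assoc[symmetric] mult_closed)
  have ve: "v \<star> e = v" using fD y b eD by (simp add: v_def mult_assoc mult_closed)
  have "?u \<star> v = ?u \<star> f \<star> y \<star> b" using u fD y b by (simp only: v_def mult_assoc mult_closed)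
  also have "\<dots> = ?u \<star> y \<star> (e \<star> b)" by (simp only: uf b)
  also have "\<dots> = ?a \<star> b" using u y b eD by (simp only: mult_assoc mult_closed)
  also have "\<dots> = e" by (fact b(4))
  finally have uv: "?u \<star> v = e" .
  let ?w = "v \<star> ?u"
  have w: "?w \<in> carrier A" using v u by (simp add: mult_closed)
  have fw: "f \<star> ?w = ?w" using fv fD v u by (simp add: mult_assoc[symmetric])
  have wf: "?w \<star> f = ?w" using uf fD v u by (simp add: mult_assoc)
  have ww: "?w \<star> ?w = ?w"
  proof -
    have "?w \<star> ?w = v \<star> (?u \<star> v) \<star> ?u" using u v by (simp only: mult_assoc mult_closed)
    then show ?thesis by (simp only: uv ve)
  qed
  \<comment> \<open>Otherwise \<open>u = e u = u v u\<close> would be zero.\<close>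
  have "?w \<noteq> \<zero>\<^bsub>A\<^esub>"
  proof
    assume "?w = \<zero>\<^bsub>A\<^esub>"
    then have "?u \<star> ?w = \<zero>\<^bsub>A\<^esub>" using u by simp
    then have "e \<star> ?u = \<zero>\<^bsub>A\<^esub>" using u v uv by (simp add: mult_assoc[symmetric])
    then show False using eu x(2) by simp
  qed
  then obtain c where c: "c \<in> carrier A" "c \<star> ?w = f"
    using division_idempotent_inverse[OF f w fw wf] by metis
  \<comment> \<open>Multiplying \<open>w w = w\<close> by the inverse \<open>c\<close> cancels one
    factor.\<close>
  have "?w = f \<star> ?w" by (simp only: fw)
  also have "\<dots> = c \<star> (?w \<star> ?w)" using c w by (simp only: mult_assoc[symmetric] mult_closed)
  also have "\<dots> = f" using c by (simp only: ww)
  finally have "?w = f" .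
  then show thesis
    using that[of ?u v] u v uv eu uf fv ve by (simp add: equivalent_via_def)
qed

section \<open>Corner algebras\<close>

text \<open>For an idempotent \<open>p\<close> this is \<open>p A p\<close>, whose elements are
  exactly those fixed by \<open>p\<close> on both sides. They keep the element type of
  \<open>A\<close>, and the unity is \<open>p\<close>.\<close>

definition corner :: "'c \<Rightarrow> ('a, 'c) module" where
  "corner p = \<lparr>carrier = {x \<in> carrier A. p \<star> x = x \<and> x \<star> p = x},
    monoid.mult = monoid.mult A, monoid.one = p, ring.zero = ring.zero A, ring.add = ring.add A,
    module.smult = module.smult A\<rparr>"

lemma corner_simps [simp]:
  "x \<in> carrier (corner p) \<longleftrightarrow> x \<in> carrier A \<and> p \<star> x = x \<and> x \<star> p = x"
  "monoid.mult (corner p) = monoid.mult A" "\<one>\<^bsub>corner p\<^esub> = p" "\<zero>\<^bsub>corner p\<^esub> = \<zero>\<^bsub>A\<^esub>"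
  "ring.add (corner p) = ring.add A" "module.smult (corner p) = module.smult A"
  by (simp_all add: corner_def)

lemma corner_abelian_group:
  assumes "p \<in> carrier A"
  shows "abelian_group (corner p)"
proof (rule abelian_groupI)
  show "\<exists>y\<in>carrier (corner p). y \<oplus>\<^bsub>corner p\<^esub> x = \<zero>\<^bsub>corner p\<^esub>" if "x \<in> carrier (corner p)" for x
  proof
    \<comment> \<open>Writing the negative as a difference from zero lets the distributive laws for
      differences apply.\<close>
    have "p \<star> (\<zero>\<^bsub>A\<^esub> \<ominus>\<^bsub>A\<^esub> x) = \<zero>\<^bsub>A\<^esub> \<ominus>\<^bsub>A\<^esub> x" "(\<zero>\<^bsub>A\<^esub> \<ominus>\<^bsub>A\<^esub> x) \<star> p = \<zero>\<^bsub>A\<^esub> \<ominus>\<^bsub>A\<^esub> x"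
      using that assms mult_diff_left[of "\<zero>\<^bsub>A\<^esub>" x p] mult_diff_right[of "\<zero>\<^bsub>A\<^esub>" x p] by auto
    then show "\<ominus>\<^bsub>A\<^esub> x \<in> carrier (corner p)" using that by (simp add: a_minus_def)
    show "(\<ominus>\<^bsub>A\<^esub> x) \<oplus>\<^bsub>corner p\<^esub> x = \<zero>\<^bsub>corner p\<^esub>" using that by (simp add: M.l_neg)
  qed
qed (use assms in \<open>auto simp: mult_add_left mult_add_right M.a_ac\<close>)

lemma corner_division_algebra:
  assumes p: "division_idempotent p"
  shows "division_algebra F (corner p)"
proof -
  note pD = division_idempotentD[OF p]
  have "module F (corner p)"
    by (rule moduleI)
      (use pD in \<open>auto simp: mult_smult_left mult_smult_right smult_l_distr smult_r_distr
        smult_assoc1 intro: corner_abelian_group R.cring_axioms\<close>)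
  then have "vectorspace F (corner p)"
    by (simp add: vectorspace_def field_axioms)
  then have alg: "assoc_algebra F (corner p)"
    using pD unfolding assoc_algebra_def assoc_algebra_axioms_def
    by (auto simp: mult_closed mult_assoc[symmetric] mult_add_left mult_add_right
        mult_smult_left mult_smult_right) (auto simp: mult_assoc)
  have mon: "monoid (corner p)"
    by (rule monoidI) (use pD in \<open>auto simp: mult_closed mult_assoc[symmetric]\<close>, auto simp: mult_assoc)
  have units: "Units (corner p) = carrier (corner p) - {\<zero>\<^bsub>corner p\<^esub>}"
  proof (intro equalityI subsetI)
    fix x assume "x \<in> Units (corner p)"
    then show "x \<in> carrier (corner p) - {\<zero>\<^bsub>corner p\<^esub>}"
      using pD by (auto simp: Units_def)
  next
    fix x assume x: "x \<in> carrier (corner p) - {\<zero>\<^bsub>corner p\<^esub>}"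
    then obtain b where "b \<in> carrier A" "p \<star> b = b" "b \<star> p = b" "b \<star> x = p" "x \<star> b = p"
      using division_idempotent_inverse[OF p, of x] by auto
    then show "x \<in> Units (corner p)" using x by (auto simp: Units_def)
  qed
  show ?thesis
    using alg mon units pD
    by (simp add: division_algebra_def division_algebra_axioms_def)
qed

text \<open>A sum formed in the corner is a different term from the sum in \<open>A\<close>, but
  both recursions use the same zero and addition.\<close>

lemma finsum_corner:
  assumes "p \<in> carrier A" "finite I" "f \<in> I \<rightarrow> carrier (corner p)"
  shows "(\<Oplus>\<^bsub>corner p\<^esub>i\<in>I. f i) = (\<Oplus>\<^bsub>A\<^esub>i\<in>I. f i)"
proof -
  interpret C: abelian_group "corner p" by (rule corner_abelian_group[OF assms(1)])
  show ?thesis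
    using assms(2,3)
  proof (induction I rule: finite_induct)
    case empty
    show ?case by (simp only: C.finsum_empty M.finsum_empty corner_simps)
  next
    case (insert i I)
    have "f \<in> I \<rightarrow> carrier (corner p)" "f i \<in> carrier (corner p)" using insert.prems by auto
    moreover from this have "f \<in> I \<rightarrow> carrier A" "f i \<in> carrier A" by auto
    ultimately have "(\<Oplus>\<^bsub>corner p\<^esub>j\<in>insert i I. f j) = f i \<oplus>\<^bsub>corner p\<^esub> (\<Oplus>\<^bsub>corner p\<^esub>j\<in>I. f j)"
      and "(\<Oplus>\<^bsub>A\<^esub>j\<in>insert i I. f j) = f i \<oplus>\<^bsub>A\<^esub> (\<Oplus>\<^bsub>A\<^esub>j\<in>I. f j)"
      using insert.hyps by (blast intro: C.finsum_insert M.finsum_insert)+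
    then show ?case using insert.IH insert.prems by simp
  qed
qed

end

section \<open>Matrix coordinates with respect to block matrix units\<close>

text \<open>The index \<open>(c, i)\<close> is position \<open>i\<close> in block \<open>c\<close>.
  The products \<open>u (c, i) v (c, j)\<close> are the matrix units of block \<open>c\<close>, and
  the idempotents \<open>u s v s\<close> are orthogonal with the unity as their sum.\<close>

locale block_matrix_units = assoc_algebra F A
  for F :: "('f, 'k) ring_scheme" (structure) and A :: "('f, 'a, 'm) module_scheme" (structure) +
  fixes r :: nat and n :: "nat \<Rightarrow> nat" and p :: "nat \<Rightarrow> 'a" and u v :: "nat \<times> nat \<Rightarrow> 'a"
    and S :: "(nat \<times> nat) set"
  assumes S_def: "S = (SIGMA c:{..<r}. {..<n c})"
    and p: "\<And>c. c < r \<Longrightarrow> division_idempotent (p c)"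
    and u_closed: "\<And>s. s \<in> S \<Longrightarrow> u s \<in> carrier A"
    and v_closed: "\<And>s. s \<in> S \<Longrightarrow> v s \<in> carrier A"
    and u_p: "\<And>s. s \<in> S \<Longrightarrow> u s \<star> p (fst s) = u s"
    and p_v: "\<And>s. s \<in> S \<Longrightarrow> p (fst s) \<star> v s = v s"
    and v_u: "\<And>s. s \<in> S \<Longrightarrow> v s \<star> u s = p (fst s)"
    and v_u_distinct: "\<And>s t. s \<in> S \<Longrightarrow> t \<in> S \<Longrightarrow> s \<noteq> t \<Longrightarrow> v s \<star> u t = \<zero>\<^bsub>A\<^esub>"
    and off_block: "\<And>s t a. s \<in> S \<Longrightarrow> t \<in> S \<Longrightarrow> fst s \<noteq> fst t \<Longrightarrow> a \<in> carrier A \<Longrightarrow>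
      v s \<star> a \<star> u t = \<zero>\<^bsub>A\<^esub>"
    and unity_left: "\<And>x. x \<in> carrier A \<Longrightarrow> (\<Oplus>\<^bsub>A\<^esub>s\<in>S. u s \<star> v s) \<star> x = x"
    and unity_right: "\<And>x. x \<in> carrier A \<Longrightarrow> x \<star> (\<Oplus>\<^bsub>A\<^esub>s\<in>S. u s \<star> v s) = x"
begin

lemma finite_S: "finite S" by (simp add: S_def)

lemma S_iff: "(c, i) \<in> S \<longleftrightarrow> c < r \<and> i < n c" by (simp add: S_def)

definition blocks where
  "blocks = product_algebra {..<r} (\<lambda>c. matrix_algebra (n c) (corner (p c)))"

definition to_blocks where
  "to_blocks a = (\<lambda>c\<in>{..<r}. \<lambda>(i, j)\<in>{..<n c} \<times> {..<n c}. v (c, i) \<star> a \<star> u (c, j))"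

text \<open>The element of \<open>A\<close> whose only possibly nonzero coordinate is the entry of
  \<open>M\<close> at \<open>s\<close>, \<open>t\<close>. Pairs from different blocks have no entry
  and contribute zero.\<close>

definition entry where
  "entry M s t = (if fst s = fst t then u s \<star> M (fst s) (snd s, snd t) \<star> v t else \<zero>\<^bsub>A\<^esub>)"

definition of_blocks where
  "of_blocks M = (\<Oplus>\<^bsub>A\<^esub>s\<in>S. \<Oplus>\<^bsub>A\<^esub>t\<in>S. entry M s t)"

lemma blocks_entry:
  assumes "M \<in> carrier blocks" "c < r" "i < n c" "j < n c"
  shows "M c (i, j) \<in> carrier (corner (p c))"
proof -
  have "M c \<in> {..<n c} \<times> {..<n c} \<rightarrow>\<^sub>E carrier (corner (p c))"
    using assms(1,2) by (auto simp: blocks_def product_algebra_def matrix_algebra_def)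
  then show ?thesis using assms(3,4) by blast
qed

lemma coordinate_closed:
  assumes a: "a \<in> carrier A" and s: "s \<in> S" "t \<in> S" "fst s = fst t"
  shows "v s \<star> a \<star> u t \<in> carrier (corner (p (fst s)))"
proof -
  have "p (fst s) \<in> carrier A"
    using p division_idempotentD(1) s by (auto simp: S_def)
  then show ?thesis
    using a u_closed[OF s(2)] v_closed[OF s(1)] u_p[OF s(2)] p_v[OF s(1)] s(3)
    by (simp add: mult_closed mult_assoc) (simp add: mult_closed mult_assoc[symmetric])
qed

lemma to_blocks_closed: "a \<in> carrier A \<Longrightarrow> to_blocks a \<in> carrier blocks"
  using coordinate_closed
  by (auto simp: to_blocks_def blocks_def product_algebra_def matrix_algebra_def S_iff
      restrict_def PiE_iff extensional_def split: prod.splits)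

lemma entry_closed:
  assumes "M \<in> carrier blocks" "s \<in> S" "t \<in> S"
  shows "entry M s t \<in> carrier A"
proof (cases "fst s = fst t")
  case True
  then have "M (fst s) (snd s, snd t) \<in> carrier A"
    using blocks_entry[OF assms(1), of "fst s" "snd s" "snd t"] assms(2,3)
    by (cases s, cases t) (auto simp: S_iff)
  then show ?thesis using True assms u_closed v_closed by (simp add: entry_def mult_closed)
qed (simp add: entry_def)

lemma of_blocks_closed: "M \<in> carrier blocks \<Longrightarrow> of_blocks M \<in> carrier A"
  unfolding of_blocks_def by (intro M.finsum_closed Pi_I entry_closed)

text \<open>The double sum is a Peirce decomposition: the idempotents \<open>u s v s\<close> sum to
  the unity, and multiplying \<open>a\<close> by this sum on both sides returns
  \<open>a\<close>.\<close>

lemma of_to_blocks: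
  assumes a: "a \<in> carrier A"
  shows "of_blocks (to_blocks a) = a"
proof -
  let ?e = "\<lambda>s. u s \<star> v s"
  have e: "?e s \<in> carrier A" if "s \<in> S" for s using that u_closed v_closed by (simp add: mult_closed)
  have entry: "entry (to_blocks a) s t = ?e s \<star> a \<star> ?e t" if s: "s \<in> S" and t: "t \<in> S" for s t
  proof -
    have "?e s \<star> a \<star> ?e t = u s \<star> (v s \<star> a \<star> u t) \<star> v t"
      using a s t u_closed v_closed by (simp add: mult_assoc mult_closed)
    \<comment> \<open>For different blocks both sides vanish, the left by definition of
      \<open>entry\<close> and the right by \<open>off_block\<close>.\<close>
    then show ?thesis
      using a s t off_block[OF s t _ a] u_closed v_closed
      by (cases s, cases t) (auto simp: entry_def to_blocks_def S_iff)
  qed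
  have "of_blocks (to_blocks a) = (\<Oplus>\<^bsub>A\<^esub>s\<in>S. \<Oplus>\<^bsub>A\<^esub>t\<in>S. ?e s \<star> a \<star> ?e t)"
    unfolding of_blocks_def using e a
    by (intro M.finsum_cong' M.finsum_closed Pi_I) (auto simp: entry mult_closed)
  also have "\<dots> = (\<Oplus>\<^bsub>A\<^esub>s\<in>S. ?e s \<star> a)"
  proof (rule M.finsum_cong')
    fix s assume s: "s \<in> S"
    have "(\<Oplus>\<^bsub>A\<^esub>t\<in>S. ?e s \<star> a \<star> ?e t) = ?e s \<star> a \<star> (\<Oplus>\<^bsub>A\<^esub>t\<in>S. ?e t)"
      using e[OF s] e a by (intro mult_finsum_right[symmetric] finite_S) (auto simp: mult_closed)
    then show "(\<Oplus>\<^bsub>A\<^esub>t\<in>S. ?e s \<star> a \<star> ?e t) = ?e s \<star> a"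
      using e[OF s] a by (simp add: unity_right mult_closed)
  qed (use e a in \<open>auto simp: mult_closed\<close>)
  also have "\<dots> = (\<Oplus>\<^bsub>A\<^esub>s\<in>S. ?e s) \<star> a"
    using e a by (intro mult_finsum_left[symmetric] finite_S) auto
  finally show ?thesis using a by (simp add: unity_left)
qed

text \<open>Multiplying the double sum by \<open>v s0\<close> on the left and \<open>u t0\<close> on
  the right leaves one term, since \<open>v s u t\<close> vanishes for distinct indices.\<close>

lemma to_of_blocks:
  assumes M: "M \<in> carrier blocks"
  shows "to_blocks (of_blocks M) = M"
proof -
  have coordinate: "v (c, i) \<star> of_blocks M \<star> u (c, j) = M c (i, j)"
    if c: "c < r" and i: "i < n c" and j: "j < n c" for c i j
  proof -
    define s0 t0 where "s0 = (c, i)" and "t0 = (c, j)"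
    have st0: "s0 \<in> S" "t0 \<in> S" using c i j by (auto simp: s0_def t0_def S_iff)
    have m: "M c (i, j) \<in> carrier (corner (p c))" by (rule blocks_entry[OF M c i j])
    note en = entry_closed[OF M]
    have entry_eq: "v s0 \<star> entry M s t \<star> u t0 =
      (if s0 = s then if t0 = t then M c (i, j) else \<zero>\<^bsub>A\<^esub> else \<zero>\<^bsub>A\<^esub>)"
      if s: "s \<in> S" and t: "t \<in> S" for s t
    proof (cases "fst s = fst t")
      case True
      let ?m = "M (fst s) (snd s, snd t)"
      have mA: "?m \<in> carrier A"
        using blocks_entry[OF M, of "fst s" "snd s" "snd t"] s t True
        by (cases s, cases t) (auto simp: S_iff)
      \<comment> \<open>The regrouping exposes \<open>v s0 u s\<close> and \<open>v t u t0\<close>.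
        Each is zero or \<open>p c\<close>, and \<open>p c\<close> fixes the entry.\<close>
      have "v s0 \<star> entry M s t \<star> u t0 = (v s0 \<star> u s) \<star> ?m \<star> (v t \<star> u t0)"
        using True mA s t st0 u_closed v_closed by (simp add: entry_def mult_assoc mult_closed)
      also have "\<dots> = (if s0 = s then if t0 = t then M c (i, j) else \<zero>\<^bsub>A\<^esub> else \<zero>\<^bsub>A\<^esub>)"
        using v_u_distinct[OF st0(1) s] v_u_distinct[OF t st0(2)] v_u[OF st0(1)] v_u[OF st0(2)]
          m mA s t st0 u_closed v_closed p[OF c] division_idempotentD(1)[OF p[OF c]]
        by (auto simp: s0_def t0_def mult_closed)
      finally show ?thesis .
    next
      case False
      then show ?thesis
        using st0 s t u_closed v_closed by (auto simp: entry_def s0_def t0_def)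
    qed
    have inner: "v s0 \<star> (\<Oplus>\<^bsub>A\<^esub>t\<in>S. entry M s t) \<star> u t0 = (if s0 = s then M c (i, j) else \<zero>\<^bsub>A\<^esub>)"
      if s: "s \<in> S" for s
    proof -
      have "v s0 \<star> (\<Oplus>\<^bsub>A\<^esub>t\<in>S. entry M s t) = (\<Oplus>\<^bsub>A\<^esub>t\<in>S. v s0 \<star> entry M s t)"
        using st0 v_closed en s by (intro mult_finsum_right finite_S) auto
      also have "\<dots> \<star> u t0 = (\<Oplus>\<^bsub>A\<^esub>t\<in>S. v s0 \<star> entry M s t \<star> u t0)"
        using st0 u_closed v_closed en s
        by (intro mult_finsum_left finite_S) (auto simp: mult_closed)
      also have "\<dots> = (\<Oplus>\<^bsub>A\<^esub>t\<in>S. if t0 = t then if s0 = s then M c (i, j) else \<zero>\<^bsub>A\<^esub> else \<zero>\<^bsub>A\<^esub>)"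
        using m s by (intro M.finsum_cong') (auto simp: entry_eq)
      also have "\<dots> = (if s0 = s then M c (i, j) else \<zero>\<^bsub>A\<^esub>)"
        using m st0(2) finite_S by (intro M.finsum_singleton) auto
      finally show ?thesis .
    qed
    have "v s0 \<star> of_blocks M = (\<Oplus>\<^bsub>A\<^esub>s\<in>S. v s0 \<star> (\<Oplus>\<^bsub>A\<^esub>t\<in>S. entry M s t))"
      unfolding of_blocks_def using st0 v_closed en
      by (intro mult_finsum_right finite_S) auto
    also have "\<dots> \<star> u t0 = (\<Oplus>\<^bsub>A\<^esub>s\<in>S. v s0 \<star> (\<Oplus>\<^bsub>A\<^esub>t\<in>S. entry M s t) \<star> u t0)"
      using st0 u_closed v_closed en
      by (intro mult_finsum_left finite_S) (auto simp: mult_closed)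
    also have "\<dots> = (\<Oplus>\<^bsub>A\<^esub>s\<in>S. if s0 = s then M c (i, j) else \<zero>\<^bsub>A\<^esub>)"
      using m by (intro M.finsum_cong') (auto simp: inner)
    also have "\<dots> = M c (i, j)"
      using m st0(1) finite_S by (intro M.finsum_singleton) auto
    finally show ?thesis by (simp add: s0_def t0_def)
  qed
  \<comment> \<open>Outside the index ranges both sides take the default value of extensional
    functions.\<close>
  have M1: "M \<in> extensional {..<r}" and M2: "\<And>c. c < r \<Longrightarrow> M c \<in> extensional ({..<n c} \<times> {..<n c})"
    using M by (auto simp: blocks_def product_algebra_def matrix_algebra_def PiE_iff)
  show ?thesis
  proof
    fix c
    show "to_blocks (of_blocks M) c = M c"
    proof (cases "c < r")
      case True
      show ?thesis
      proof
        fix ij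
        show "to_blocks (of_blocks M) c ij = M c ij"
          using True coordinate[OF True] extensional_arb[OF M2[OF True], of ij]
          by (cases ij) (auto simp: to_blocks_def restrict_def)
      qed
    next
      case False
      then show ?thesis using extensional_arb[OF M1, of c] by (simp add: to_blocks_def)
    qed
  qed
qed

lemma to_blocks_add:
  assumes "a \<in> carrier A" "b \<in> carrier A"
  shows "to_blocks (a \<oplus>\<^bsub>A\<^esub> b) = to_blocks a \<oplus>\<^bsub>blocks\<^esub> to_blocks b"
  using assms u_closed v_closed
  by (auto simp: to_blocks_def blocks_def product_algebra_def matrix_algebra_def S_iff
      mult_add_left mult_add_right mult_closed fun_eq_iff restrict_def)

lemma to_blocks_smult:
  assumes "c \<in> carrier F" "a \<in> carrier A"
  shows "to_blocks (c \<odot>\<^bsub>A\<^esub> a) = c \<odot>\<^bsub>blocks\<^esub> to_blocks a"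
  using assms u_closed v_closed
  by (auto simp: to_blocks_def blocks_def product_algebra_def matrix_algebra_def S_iff
      mult_smult_left mult_smult_right mult_closed fun_eq_iff restrict_def)

text \<open>The unity, as the sum of all \<open>u s v s\<close>, is inserted between
  \<open>a\<close> and \<open>b\<close>. \<open>off_block\<close> removes the terms outside block
  \<open>c\<close>.\<close>

lemma coordinate_mult:
  assumes a: "a \<in> carrier A" and b: "b \<in> carrier A" and c: "c < r" and i: "i < n c" and j: "j < n c"
  shows "v (c, i) \<star> (a \<star> b) \<star> u (c, j) =
    (\<Oplus>\<^bsub>A\<^esub>k\<in>{..<n c}. (v (c, i) \<star> a \<star> u (c, k)) \<star> (v (c, k) \<star> b \<star> u (c, j)))"
proof -
  have cl: "v (c, i) \<in> carrier A" "u (c, j) \<in> carrier A"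
    using c i j u_closed v_closed by (auto simp: S_iff)
  define g where "g s = (v (c, i) \<star> a \<star> u s) \<star> (v s \<star> b \<star> u (c, j))" for s
  have g: "g \<in> S \<rightarrow> carrier A" using cl a b u_closed v_closed by (auto simp: g_def mult_closed)
  have uv: "(\<lambda>s. u s \<star> v s) \<in> S \<rightarrow> carrier A" using u_closed v_closed by (auto simp: mult_closed)
  have "v (c, i) \<star> (a \<star> b) \<star> u (c, j) =
    v (c, i) \<star> a \<star> (\<Oplus>\<^bsub>A\<^esub>s\<in>S. u s \<star> v s) \<star> (b \<star> u (c, j))"
    using cl a b by (simp add: mult_assoc mult_closed unity_right)
  also have "v (c, i) \<star> a \<star> (\<Oplus>\<^bsub>A\<^esub>s\<in>S. u s \<star> v s) = (\<Oplus>\<^bsub>A\<^esub>s\<in>S. v (c, i) \<star> a \<star> (u s \<star> v s))"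
    using cl a by (intro mult_finsum_right finite_S uv) (simp add: mult_closed)
  also have "\<dots> \<star> (b \<star> u (c, j)) = (\<Oplus>\<^bsub>A\<^esub>s\<in>S. v (c, i) \<star> a \<star> (u s \<star> v s) \<star> (b \<star> u (c, j)))"
    by (intro mult_finsum_left finite_S) (use cl a b u_closed v_closed in \<open>auto simp: mult_closed\<close>)
  also have "\<dots> = (\<Oplus>\<^bsub>A\<^esub>s\<in>S. g s)"
    using cl a b u_closed v_closed g
    by (intro M.finsum_cong') (auto simp: g_def mult_assoc mult_closed)
  also have "\<dots> = (\<Oplus>\<^bsub>A\<^esub>s\<in>Pair c ` {..<n c}. g s)"
  proof (rule M.add.finprod_mono_neutral_cong_right[OF finite_S])
    show "g s = \<zero>\<^bsub>A\<^esub>" if s: "s \<in> S - Pair c ` {..<n c}" for s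
    proof -
      have "fst s \<noteq> c" using s by (cases s) (auto simp: S_iff)
      then have "v (c, i) \<star> a \<star> u s = \<zero>\<^bsub>A\<^esub>"
        using off_block[of "(c, i)" s a] s a c i by (auto simp: S_iff)
      then show ?thesis using s b cl v_closed by (simp add: g_def mult_closed)
    qed
  qed (use c g in \<open>auto simp: S_iff\<close>)
  also have "\<dots> = (\<Oplus>\<^bsub>A\<^esub>k\<in>{..<n c}. g (c, k))"
    using c g by (intro M.add.finprod_reindex) (auto simp: S_iff inj_on_def)
  finally show ?thesis by (simp add: g_def)
qed

text \<open>The matrix product sums in the corner, \<open>coordinate_mult\<close> in
  \<open>A\<close>; \<open>finsum_corner\<close> identifies the two.\<close>

lemma to_blocks_mult:
  assumes "a \<in> carrier A" "b \<in> carrier A"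
  shows "to_blocks (a \<star> b) = to_blocks a \<otimes>\<^bsub>blocks\<^esub> to_blocks b"
proof -
  have "v (c, i) \<star> (a \<star> b) \<star> u (c, j) =
    (\<Oplus>\<^bsub>corner (p c)\<^esub>k\<in>{..<n c}. to_blocks a c (i, k) \<star> to_blocks b c (k, j))"
    if c: "c < r" and ij: "i < n c" "j < n c" for c i j
  proof -
    have pc: "p c \<in> carrier A" using p[OF c] by (rule division_idempotentD)
    have cl: "to_blocks x c (k, l) \<in> carrier (corner (p c))"
      if "x \<in> carrier A" "k < n c" "l < n c" for x k l
      using blocks_entry[OF to_blocks_closed[OF that(1)] c that(2,3)] .
    have "(\<Oplus>\<^bsub>corner (p c)\<^esub>k\<in>{..<n c}. to_blocks a c (i, k) \<star> to_blocks b c (k, j)) =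
      (\<Oplus>\<^bsub>A\<^esub>k\<in>{..<n c}. to_blocks a c (i, k) \<star> to_blocks b c (k, j))"
    proof (rule finsum_corner[OF pc])
      show "(\<lambda>k. to_blocks a c (i, k) \<star> to_blocks b c (k, j)) \<in> {..<n c} \<rightarrow> carrier (corner (p c))"
      proof
        fix k assume "k \<in> {..<n c}"
        then have "to_blocks a c (i, k) \<in> carrier (corner (p c))"
          "to_blocks b c (k, j) \<in> carrier (corner (p c))" using cl assms ij by auto
        then show "to_blocks a c (i, k) \<star> to_blocks b c (k, j) \<in> carrier (corner (p c))"
          using pc by (auto simp: mult_closed mult_assoc[symmetric]) (auto simp: mult_assoc)
      qed
    qed simp
    also have "\<dots> = v (c, i) \<star> (a \<star> b) \<star> u (c, j)"
      unfolding coordinate_mult[OF assms c ij] using c ij assms u_closed v_closed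
      by (intro M.finsum_cong') (auto simp: to_blocks_def S_iff mult_closed)
    finally show ?thesis by simp
  qed
  then show ?thesis
    unfolding to_blocks_def[of "a \<star> b"]
    by (auto simp: blocks_def product_algebra_def matrix_algebra_def fun_eq_iff restrict_def)
qed

lemma isomorphic_blocks: "algebra_isomorphic F A blocks"
proof -
  have "bij_betw to_blocks (carrier A) (carrier blocks)"
    by (rule bij_betw_byWitness[of _ of_blocks])
      (use of_to_blocks to_of_blocks to_blocks_closed of_blocks_closed in auto)
  moreover have "to_blocks \<in> module_hom F A blocks"
    using to_blocks_closed to_blocks_add to_blocks_smult by (simp add: module_hom_def)
  ultimately show ?thesis
    unfolding algebra_isomorphic_def using to_blocks_mult by blast
qed

end

section \<open>Decomposition of a semiprime algebra\<close>

context assoc_algebra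
begin

lemma semiprime_decomposition:
  assumes "fin_dim" and semi: "semiprime A" and nonzero: "a \<in> carrier A" "a \<noteq> \<zero>\<^bsub>A\<^esub>"
  shows "\<exists>r n p. matrix_decomposition F A r n (\<lambda>c. corner (p c))"
proof -
  obtain E where E: "orthogonal_family E"
    and one_left: "\<And>x. x \<in> carrier A \<Longrightarrow> (\<Oplus>\<^bsub>A\<^esub>e\<in>E. e) \<star> x = x"
    and one_right: "\<And>x. x \<in> carrier A \<Longrightarrow> x \<star> (\<Oplus>\<^bsub>A\<^esub>e\<in>E. e) = x"
    using exists_complete_orthogonal_family[OF \<open>fin_dim\<close> semi] by blast
  have finE: "finite E" and div: "\<And>e. e \<in> E \<Longrightarrow> division_idempotent e"
    and ort: "\<And>e f. e \<in> E \<Longrightarrow> f \<in> E \<Longrightarrow> e \<noteq> f \<Longrightarrow> e \<star> f = \<zero>\<^bsub>A\<^esub>"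
    using E by (auto simp: orthogonal_family_def)
  have EA: "e \<in> carrier A" and idem: "e \<star> e = e" if "e \<in> E" for e
    using div[OF that] by (auto simp: division_idempotent_def)
  \<comment> \<open>An empty family would have sum zero, which cannot fix the nonzero
    \<open>a\<close>.\<close>
  have "E \<noteq> {}" using one_left[OF nonzero(1)] nonzero by auto
  define K where "K = {(e, f). e \<in> E \<and> f \<in> E \<and> (\<exists>w y. equivalent_via e f w y)}"
  have K: "equiv E K"
  proof (rule equivI)
    show "K \<subseteq> E \<times> E" by (auto simp: K_def)
    have "equivalent_via e e e e" if "e \<in> E" for e
      using EA[OF that] idem[OF that] by (simp add: equivalent_via_def)
    then show "refl_on E K" by (auto simp: refl_on_def K_def)
    show "sym K" by (auto simp: sym_def K_def equivalent_via_def)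
    show "trans K" using equivalent_via_trans by (fastforce simp: trans_def K_def)
  qed
  have finQ: "finite (E // K)" by (rule finite_quotient[OF finE]) (auto simp: K_def)
  define r where "r = card (E // K)"
  \<comment> \<open>\<open>h\<close> numbers the equivalence classes, and \<open>k c\<close> below
    numbers the members of the class \<open>h c\<close>.\<close>
  obtain h where h: "bij_betw h {..<r} (E // K)"
    using ex_bij_betw_nat_finite[OF finQ] by (auto simp: r_def atLeast0LessThan)
  define n where "n c = card (h c)" for c
  have hQ: "h c \<in> E // K" if "c < r" for c using h that by (auto simp: bij_betw_def)
  have hE: "h c \<subseteq> E" if "c < r" for c
    using in_quotient_imp_subset[OF K hQ[OF that]] .
  have "\<exists>k. bij_betw k {..<n c} (h c)" if "c < r" for c
    using ex_bij_betw_nat_finite[OF finite_subset[OF hE[OF that] finE]]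
    by (auto simp: n_def atLeast0LessThan)
  then obtain k where k: "\<And>c. c < r \<Longrightarrow> bij_betw (k c) {..<n c} (h c)" by metis
  define g where "g s = k (fst s) (snd s)" for s
  \<comment> \<open>The first member of a class represents it; it exists because \<open>n c\<close>
    is at least one.\<close>
  define p where "p c = k c 0" for c
  define S where "S = (SIGMA c:{..<r}. {..<n c})"
  have g_class: "g s \<in> h (fst s)" "fst s < r" if "s \<in> S" for s
    using that bij_betwE[OF k] by (auto simp: S_def g_def)
  have gE: "g s \<in> E" if "s \<in> S" for s using g_class[OF that] hE by auto
  have n: "n c \<ge> 1" if c: "c < r" for c
  proof -
    have "h c \<noteq> {}" using in_quotient_imp_non_empty[OF K hQ[OF c]] .
    then show ?thesis using finite_subset[OF hE[OF c] finE] by (simp add: n_def Suc_le_eq card_gt_0_iff)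
  qed
  have p_class: "p c \<in> h c" if "c < r" for c
    using k[OF that] n[OF that] by (auto simp: p_def bij_betw_def)
  have same_class: "fst s = fst t" if s: "s \<in> S" and t: "t \<in> S" and st: "(g s, g t) \<in> K" for s t
  proof -
    have "h (fst s) = h (fst t)"
      using quotient_eqI[OF K hQ hQ g_class(1)[OF s] g_class(1)[OF t] st] g_class s t by blast
    then show ?thesis using h g_class(2) s t by (auto simp: bij_betw_def inj_on_def)
  qed
  \<comment> \<open>Together with surjectivity below, this lets \<open>g\<close> reindex the sum
    over \<open>E\<close> by blocks and positions.\<close>
  have "inj_on g S"
  proof (rule inj_onI)
    fix s t assume st: "s \<in> S" "t \<in> S" "g s = g t"
    have "(g t, g t) \<in> K" using gE[OF st(2)] equiv_class_self[OF K] by blast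
    then have "fst s = fst t" using same_class st by metis
    moreover from this have "snd s = snd t"
      using st k[of "fst t"] by (auto simp: S_def g_def bij_betw_def inj_on_def)
    ultimately show "s = t" by (simp add: prod_eq_iff)
  qed
  moreover have "E \<subseteq> g ` S"
  proof
    fix e assume e: "e \<in> E"
    then have "K `` {e} \<in> h ` {..<r}" using h by (auto simp: bij_betw_def intro: quotientI)
    then obtain c where c: "c < r" "K `` {e} = h c" by auto
    have "e \<in> h c" using equiv_class_self[OF K e] c by simp
    then have "e \<in> k c ` {..<n c}" using k[OF c(1)] by (simp add: bij_betw_def)
    then obtain i where "i < n c" "e = k c i" by blast
    then show "e \<in> g ` S" using c by (intro image_eqI[of _ _ "(c, i)"]) (auto simp: g_def S_def)
  qed
  ultimately have g: "inj_on g S" "g ` S = E" using gE by auto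
  have "\<exists>w. equivalent_via (g s) (p (fst s)) (fst w) (snd w)" if s: "s \<in> S" for s
  proof -
    have "(g s, p (fst s)) \<in> K"
      using quotient_eq_iff[OF K hQ hQ] g_class[OF s] p_class by blast
    then show ?thesis by (auto simp: K_def)
  qed
  \<comment> \<open>The pair \<open>w s\<close> holds both witnesses of the equivalence between
    \<open>g s\<close> and its representative.\<close>
  then obtain w where w: "\<And>s. s \<in> S \<Longrightarrow> equivalent_via (g s) (p (fst s)) (fst (w s)) (snd (w s))"
    by metis
  define u v where "u = fst \<circ> w" and "v = snd \<circ> w"
  have uv: "u s \<in> carrier A" "v s \<in> carrier A" "u s \<star> v s = g s" "v s \<star> u s = p (fst s)"
    "g s \<star> u s = u s" "u s \<star> p (fst s) = u s" "p (fst s) \<star> v s = v s" "v s \<star> g s = v s"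
    if "s \<in> S" for s
    using w[OF that] by (simp_all add: u_def v_def equivalent_via_def)
  have one: "(\<Oplus>\<^bsub>A\<^esub>s\<in>S. u s \<star> v s) = (\<Oplus>\<^bsub>A\<^esub>e\<in>E. e)"
  proof -
    have "(\<Oplus>\<^bsub>A\<^esub>s\<in>S. u s \<star> v s) = (\<Oplus>\<^bsub>A\<^esub>s\<in>S. g s)"
      by (rule M.finsum_cong') (use uv gE EA in auto)
    also have "\<dots> = (\<Oplus>\<^bsub>A\<^esub>e\<in>g ` S. e)"
      by (rule M.add.finprod_reindex[symmetric]) (use g EA in auto)
    finally show ?thesis by (simp only: g)
  qed
  \<comment> \<open>The idempotents absorbed by \<open>v s\<close> and \<open>u t\<close> bring out
    \<open>g s x g t\<close>, which vanishes between inequivalent members.\<close>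
  have sandwich: "v s \<star> x \<star> u t = v s \<star> (g s \<star> x \<star> g t) \<star> u t"
    if s: "s \<in> S" and t: "t \<in> S" and x: "x \<in> carrier A" for s t x
  proof -
    have "v s \<star> (g s \<star> x \<star> g t) \<star> u t = (v s \<star> g s) \<star> x \<star> (g t \<star> u t)"
      using uv(1,2)[OF s] uv(1,2)[OF t] EA[OF gE[OF s]] EA[OF gE[OF t]] x
      by (simp only: mult_assoc mult_closed)
    then show ?thesis by (simp only: uv(8)[OF s] uv(5)[OF t])
  qed
  interpret block_matrix_units F A r n p u v S
  proof (unfold_locales, goal_cases)
    case 1
    show ?case by (rule S_def)
  next
    case (2 c)
    then show ?case using div hE p_class by blast
  next
    case (8 s t)
    have "v s \<star> u t = v s \<star> (g s \<star> g t) \<star> u t"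
      using uv(1,2,5,8)[OF 8(1)] uv(1,2,5,8)[OF 8(2)] EA[OF gE[OF 8(1)]] EA[OF gE[OF 8(2)]]
      by (metis mult_assoc mult_closed)
    moreover have "g s \<star> g t = \<zero>\<^bsub>A\<^esub>"
      using ort[OF gE[OF 8(1)] gE[OF 8(2)]] 8 g(1) by (auto simp: inj_on_def)
    ultimately show ?case using uv 8 by simp
  next
    case (9 s t x)
    have "g s \<star> x \<star> g t = \<zero>\<^bsub>A\<^esub>"
    proof (rule ccontr)
      \<comment> \<open>A nonzero product would make \<open>g s\<close> and \<open>g t\<close>
        equivalent and so put \<open>s\<close> and \<open>t\<close> into one block.\<close>
      assume "g s \<star> x \<star> g t \<noteq> \<zero>\<^bsub>A\<^esub>"
      then obtain w y where "equivalent_via (g s) (g t) w y"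
        using equivalent_via_if_nonzero[OF semi div[OF gE] div[OF gE]] 9 by metis
      then have "(g s, g t) \<in> K" using gE 9 by (auto simp: K_def)
      then show False using same_class 9 by blast
    qed
    then show ?case using sandwich[of s t x] uv 9 by simp
  qed (use uv one one_left one_right in auto)
  have "r \<ge> 1"
    using \<open>E \<noteq> {}\<close> finQ by (simp add: r_def Suc_le_eq card_gt_0_iff quotient_is_empty)
  then have "matrix_decomposition F A r n (\<lambda>c. corner (p c))"
    using n p isomorphic_blocks
    by (simp add: matrix_decomposition_def blocks_def corner_division_algebra)
  then show ?thesis by blast
qed

end

section \<open>Semiprimeness of products of matrix algebras\<close>

text \<open>Replacing coordinate \<open>i\<close> of \<open>a\<close> by \<open>x\<close> gives a
  test element whose other coordinates surely lie in their carriers. Coordinate \<open>i\<close> of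
  the product is then \<open>a i\<close> times \<open>x\<close> times \<open>a i\<close>.\<close>

lemma semiprime_product_algebra:
  assumes "\<And>i. i \<in> I \<Longrightarrow> semiprime (B i)"
  shows "semiprime (product_algebra I B)"
  unfolding semiprime_iff
proof (intro ballI impI)
  fix a
  assume a: "a \<in> carrier (product_algebra I B)"
    and annihilates: "\<forall>x\<in>carrier (product_algebra I B).
      a \<otimes>\<^bsub>product_algebra I B\<^esub> x \<otimes>\<^bsub>product_algebra I B\<^esub> a = \<zero>\<^bsub>product_algebra I B\<^esub>"
  have aE: "a \<in> (\<Pi>\<^sub>E i\<in>I. carrier (B i))" using a by (simp add: product_algebra_def)
  have "a i = \<zero>\<^bsub>B i\<^esub>" if i: "i \<in> I" for i
  proof -
    have "a i \<otimes>\<^bsub>B i\<^esub> x \<otimes>\<^bsub>B i\<^esub> a i = \<zero>\<^bsub>B i\<^esub>" if x: "x \<in> carrier (B i)" for x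
    proof -
      have "a(i := x) \<in> carrier (product_algebra I B)"
        using aE i x by (auto simp: product_algebra_def PiE_iff extensional_def)
      from annihilates[rule_format, OF this] show ?thesis
        using i by (auto simp: product_algebra_def fun_eq_iff dest!: spec[of _ i])
    qed
    then show ?thesis using assms[OF i] aE i by (auto simp: semiprime_iff)
  qed
  then show "a = \<zero>\<^bsub>product_algebra I B\<^esub>"
    using aE by (auto simp: product_algebra_def fun_eq_iff restrict_def PiE_iff extensional_def)
qed

lemma semiprime_matrix_algebra:
  assumes D: "division_algebra F D"
  shows "semiprime (matrix_algebra n D)"
  unfolding semiprime_iff
proof (intro ballI impI)
  interpret division_algebra F D by (rule D)
  let ?R = "matrix_algebra n D"
  fix a
  assume a: "a \<in> carrier ?R"
    and annihilates: "\<forall>x\<in>carrier ?R. a \<otimes>\<^bsub>?R\<^esub> x \<otimes>\<^bsub>?R\<^esub> a = \<zero>\<^bsub>?R\<^esub>"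
  have aE: "a \<in> {..<n} \<times> {..<n} \<rightarrow>\<^sub>E carrier D" using a by (simp add: matrix_algebra_def)
  have cl: "a (i, j) \<in> carrier D" if "i < n" "j < n" for i j using aE that by blast
  have "a (i, j) = \<zero>\<^bsub>D\<^esub>" if i: "i < n" and j: "j < n" for i j
  proof (rule ccontr)
    assume "a (i, j) \<noteq> \<zero>\<^bsub>D\<^esub>"
    then have "a (i, j) \<in> Units D" using cl[OF i j] nonzero_invertible by auto
    then have "a (i, j) \<otimes>\<^bsub>D\<^esub> a (i, j) \<in> Units D" by simp
    then have nz: "a (i, j) \<otimes>\<^bsub>D\<^esub> a (i, j) \<noteq> \<zero>\<^bsub>D\<^esub>" using nonzero_invertible by auto
    define x where "x = (\<lambda>(k, l)\<in>{..<n} \<times> {..<n}. if k = j \<and> l = i then \<one>\<^bsub>D\<^esub> else \<zero>\<^bsub>D\<^esub>)"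
    have x: "x \<in> carrier ?R" by (auto simp: x_def matrix_algebra_def)
    \<comment> \<open>Row \<open>i\<close> of \<open>a x\<close> is zero except for
      \<open>a (i, j)\<close> in column \<open>i\<close>, so the entry of \<open>a x a\<close> at
      \<open>(i, j)\<close> is the square of \<open>a (i, j)\<close>.\<close>
    have ax: "(a \<otimes>\<^bsub>?R\<^esub> x) (i, l) = (if i = l then a (i, j) else \<zero>\<^bsub>D\<^esub>)" if l: "l < n" for l
    proof -
      have "(a \<otimes>\<^bsub>?R\<^esub> x) (i, l) = (\<Oplus>\<^bsub>D\<^esub>k\<in>{..<n}. a (i, k) \<otimes>\<^bsub>D\<^esub> x (k, l))"
        using i l by (simp add: matrix_algebra_def)
      also have "\<dots> = (\<Oplus>\<^bsub>D\<^esub>k\<in>{..<n}. if j = k then if i = l then a (i, k) else \<zero>\<^bsub>D\<^esub> else \<zero>\<^bsub>D\<^esub>)"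
        using cl i l by (intro M.finsum_cong') (auto simp: x_def)
      also have "\<dots> = (if i = l then a (i, j) else \<zero>\<^bsub>D\<^esub>)"
        using cl i j by (intro M.finsum_singleton) auto
      finally show ?thesis .
    qed
    have "(a \<otimes>\<^bsub>?R\<^esub> x \<otimes>\<^bsub>?R\<^esub> a) (i, j) = (\<Oplus>\<^bsub>D\<^esub>l\<in>{..<n}. (a \<otimes>\<^bsub>?R\<^esub> x) (i, l) \<otimes>\<^bsub>D\<^esub> a (l, j))"
      using i j by (simp add: matrix_algebra_def)
    also have "\<dots> = (\<Oplus>\<^bsub>D\<^esub>l\<in>{..<n}. if i = l then a (i, j) \<otimes>\<^bsub>D\<^esub> a (l, j) else \<zero>\<^bsub>D\<^esub>)"
      using cl i j by (intro M.finsum_cong') (auto simp: ax mult_closed)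
    also have "\<dots> = a (i, j) \<otimes>\<^bsub>D\<^esub> a (i, j)"
      using cl i j by (intro M.finsum_singleton) (auto simp: mult_closed)
    finally have "(a \<otimes>\<^bsub>?R\<^esub> x \<otimes>\<^bsub>?R\<^esub> a) (i, j) \<noteq> \<zero>\<^bsub>D\<^esub>" using nz by simp
    moreover have "\<zero>\<^bsub>?R\<^esub> (i, j) = \<zero>\<^bsub>D\<^esub>" using i j by (simp add: matrix_algebra_def)
    ultimately show False using annihilates[rule_format, OF x] by simp
  qed
  then show "a = \<zero>\<^bsub>?R\<^esub>"
    using aE by (auto simp: matrix_algebra_def fun_eq_iff restrict_def PiE_iff extensional_def)
qed

text \<open>Additivity shows only that the image of zero equals its own double. As \<open>B\<close>
  is a bare record, \<open>idempotent_zero\<close> takes the place of cancellation in an additive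
  group.\<close>

lemma semiprime_isomorphic:
  assumes A: "assoc_algebra F A" and iso: "algebra_isomorphic F A B" and B: "semiprime B"
    and idempotent_zero: "\<And>y. y \<in> carrier B \<Longrightarrow> y \<oplus>\<^bsub>B\<^esub> y = y \<Longrightarrow> y = \<zero>\<^bsub>B\<^esub>"
  shows "semiprime A"
  unfolding semiprime_iff
proof (intro ballI impI)
  interpret assoc_algebra F A by (rule A)
  obtain \<phi> where hom: "\<phi> \<in> module_hom F A B" and bij: "bij_betw \<phi> (carrier A) (carrier B)"
    and mult: "\<And>a b. a \<in> carrier A \<Longrightarrow> b \<in> carrier A \<Longrightarrow> \<phi> (a \<otimes>\<^bsub>A\<^esub> b) = \<phi> a \<otimes>\<^bsub>B\<^esub> \<phi> b"
    using iso by (auto simp: algebra_isomorphic_def)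
  have zero: "\<phi> \<zero>\<^bsub>A\<^esub> = \<zero>\<^bsub>B\<^esub>"
    using idempotent_zero[of "\<phi> \<zero>\<^bsub>A\<^esub>"] module_hom_add[OF hom, of "\<zero>\<^bsub>A\<^esub>" "\<zero>\<^bsub>A\<^esub>"]
      module_hom_closed[OF hom] by auto
  fix a
  assume a: "a \<in> carrier A" and annihilates: "\<forall>x\<in>carrier A. a \<otimes>\<^bsub>A\<^esub> x \<otimes>\<^bsub>A\<^esub> a = \<zero>\<^bsub>A\<^esub>"
  have "\<phi> a \<otimes>\<^bsub>B\<^esub> y \<otimes>\<^bsub>B\<^esub> \<phi> a = \<zero>\<^bsub>B\<^esub>" if y: "y \<in> carrier B" for y
  proof -
    obtain x where x: "x \<in> carrier A" "y = \<phi> x" using y bij by (auto simp: bij_betw_def)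
    then have "\<phi> a \<otimes>\<^bsub>B\<^esub> y \<otimes>\<^bsub>B\<^esub> \<phi> a = \<phi> (a \<otimes>\<^bsub>A\<^esub> x \<otimes>\<^bsub>A\<^esub> a)"
      using a by (simp add: mult mult_closed)
    then show ?thesis using annihilates x zero by simp
  qed
  then have "\<phi> a = \<phi> \<zero>\<^bsub>A\<^esub>"
    using B a module_hom_closed[OF hom] zero by (auto simp: semiprime_iff)
  then show "a = \<zero>\<^bsub>A\<^esub>" using bij a by (auto simp: bij_betw_def inj_on_def)
qed

text \<open>The cancellation required of the product is checked entry by entry, in the additive
  groups of the division algebras.\<close>

lemma matrix_decomposition_semiprime:
  assumes A: "assoc_algebra F A" and dec: "matrix_decomposition F A r n D"
  shows "semiprime A"
proof -
  let ?B = "product_algebra {..<r} (\<lambda>i. matrix_algebra (n i) (D i))"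
  have D: "\<And>i. i < r \<Longrightarrow> division_algebra F (D i)" and iso: "algebra_isomorphic F A ?B"
    using dec by (auto simp: matrix_decomposition_def)
  show ?thesis
  proof (rule semiprime_isomorphic[OF A iso])
    show "semiprime ?B"
      using D by (intro semiprime_product_algebra semiprime_matrix_algebra[of F]) auto
    fix y assume y: "y \<in> carrier ?B" and yy: "y \<oplus>\<^bsub>?B\<^esub> y = y"
    have yc: "y c \<in> {..<n c} \<times> {..<n c} \<rightarrow>\<^sub>E carrier (D c)" if "c < r" for c
      using y that by (auto simp: product_algebra_def matrix_algebra_def)
    have "y c (i, j) = \<zero>\<^bsub>D c\<^esub>" if c: "c < r" and ij: "i < n c" "j < n c" for c i j
    proof -
      interpret division_algebra F "D c" by (rule D[OF c])
      have "(y \<oplus>\<^bsub>?B\<^esub> y) c (i, j) = y c (i, j) \<oplus>\<^bsub>D c\<^esub> y c (i, j)"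
        using c ij by (simp add: product_algebra_def matrix_algebra_def)
      moreover have "y c (i, j) \<in> carrier (D c)" using yc[OF c] ij by blast
      ultimately show ?thesis using yy by simp
    qed
    then have "y c = \<zero>\<^bsub>matrix_algebra (n c) (D c)\<^esub>" if "c < r" for c
      using yc[OF that] that
      by (auto simp: matrix_algebra_def fun_eq_iff restrict_def PiE_iff extensional_def)
    moreover have "y \<in> extensional {..<r}"
      using y by (simp add: product_algebra_def PiE_iff)
    ultimately show "y = \<zero>\<^bsub>?B\<^esub>"
      by (auto simp: product_algebra_def fun_eq_iff restrict_def extensional_def)
  qed
qed

text \<open>The corners found for a semiprime algebra have the element type of \<open>A\<close>, so
  the equivalence quantifies over that type. The second conjunct covers division algebras over any
  element type, which a quantifier inside the formula cannot range over.\<close>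

theorem theorem3p6:
  fixes F :: "('f, 'k) ring_scheme" and A :: "('f, 'a, 'm) module_scheme"
  assumes "field F"
    and "assoc_algebra F A"
    and "vectorspace.fin_dim F A"
    and "\<exists>a\<in>carrier A. a \<noteq> \<zero>\<^bsub>A\<^esub>"
  shows "(semiprime A \<longleftrightarrow>
           (\<exists>r n (D :: nat \<Rightarrow> ('f, 'a) module). matrix_decomposition F A r n D))
       \<and> (\<forall>r n (D :: nat \<Rightarrow> ('f, 'd) module). matrix_decomposition F A r n D \<longrightarrow> semiprime A)"
proof -
  interpret assoc_algebra F A by (rule assms(2))
  obtain a where a: "a \<in> carrier A" "a \<noteq> \<zero>\<^bsub>A\<^esub>" using assms(4) by blast
  have "semiprime A \<Longrightarrow> \<exists>r n (D :: nat \<Rightarrow> ('f, 'a) module). matrix_decomposition F A r n D"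
    using semiprime_decomposition[OF assms(3) _ a] by blast
  then show ?thesis
    by (blast intro: matrix_decomposition_semiprime[OF assms(2)])
qed

end
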